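(* Let $p$ be a prime number. (a) Let $n\geq 1$ be an integer. The simplicial complex $X(\mathbb{F}_p^n)$ is homotopy equivalent to the wedge of $A_n(p)$ spheres $S^{n-1}$, where $$A_n(p)=(-1)^n+\sum_{i=0}^{n-1}(-1)^{n-1-i}\frac{(p^n-p^{i})\cdots(p^n-p^0)}{(i+1)!}.$$ (b) Let $n>1$ be an integer. The simplicial complex $K(\mathbb{F}_p^n)$ is homotopy equivalent to the wedge of $B_n(p)$ spheres $S^{n-1}$, where $$B_n(p)=(-1)^n+\sum_{i=0}^{n-1}(-1)^{n-1-i}\frac{(p^n-p^{i})\cdots(p^n-p^0)}{(p-1)^{i+1}\,(i+1)!}.$$
   Context: $X(\mathbb{F}_p^n)$ is the simplicial complex whose vertices are the nonzero vectors of $\mathbb{F}_p^n$ and whose simplices are the linearly independent (unimodular) subsets of $\mathbb{F}_p^n$. $K(\mathbb{F}_p^n)$ is the simplicial complex whose vertices are the one-dimensional subspaces (lines) of $\mathbb{F}_p^n$ and whose $m$-simplices are the sets of $m+1$ lines spanning an $(m+1)$-dimensional subspace. The product $(p^n-p^i)\cdots(p^n-p^0)$ means $\prod_{j=0}^{i}(p^n-p^j)$. Homotopy equivalence refers to geometric realisations. *)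

theory Defs
  imports "HOL-Analysis.Analysis" "Berlekamp_Zassenhaus.Finite_Field"
begin

section \<open>Abstract simplicial complexes and their realisations\<close>

text \<open>A complex is given by its set of nonempty simplices.\<close>

definition abstract_simplicial_complex :: "'v set set \<Rightarrow> bool" where
  "abstract_simplicial_complex K \<longleftrightarrow>
     (\<forall>\<sigma>\<in>K. finite \<sigma> \<and> \<sigma> \<noteq> {} \<and> (\<forall>\<tau>\<subseteq>\<sigma>. \<tau> \<noteq> {} \<longrightarrow> \<tau> \<in> K))"

text \<open>
  The vertex \<open>v\<close> becomes the unit vector \<open>axis v 1\<close>. The vertex type is finite, so the complex
  is finite and the subspace topology is the weak topology. Unit vectors of elements of \<open>'v\<close> that
  are not vertices of the complex do not belong to the realisation.
\<close>

definition geometric_realisation :: "'v::finite set set \<Rightarrow> (real ^ 'v) set" where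
  "geometric_realisation K = (\<Union>\<sigma>\<in>K. convex hull ((\<lambda>v. axis v 1) ` \<sigma>))"


section \<open>The two complexes\<close>

text \<open>Over a field, unimodular means linearly independent; in particular zero is not a vertex.\<close>

definition X_complex :: "('f::field ^ 'n) set set" where
  "X_complex = {\<sigma>. finite \<sigma> \<and> \<sigma> \<noteq> {} \<and> vec.independent \<sigma>}"

definition lines :: "('f::field ^ 'n) set set" where
  "lines = {L. vec.subspace L \<and> vec.dim L = 1}"

definition K_complex :: "('f::field ^ 'n) set set set" where
  "K_complex = {\<sigma>. finite \<sigma> \<and> \<sigma> \<noteq> {} \<and> \<sigma> \<subseteq> lines \<and> vec.dim (vec.span (\<Union>\<sigma>)) = card \<sigma>}"

lemma X_complex_vertices: "{v} \<in> X_complex \<longleftrightarrow> v \<noteq> 0"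
  by (auto simp: X_complex_def vec.dependent_single)

lemma abstract_simplicial_complex_X: "abstract_simplicial_complex X_complex"
  by (auto simp: abstract_simplicial_complex_def X_complex_def
      dest: finite_subset vec.independent_mono)

lemma K_complex_vertices: "{L} \<in> K_complex \<longleftrightarrow> L \<in> lines"
  by (auto simp: K_complex_def lines_def vec.dim_span)

lemma dim_Un_le: "vec.dim (A \<union> B) \<le> vec.dim A + vec.dim (B :: ('f::field ^ 'n) set)"
proof -
  have "A \<union> B \<subseteq> {x + y |x y. x \<in> vec.span A \<and> y \<in> vec.span B}" (is "_ \<subseteq> ?S")
  proof
    fix z assume "z \<in> A \<union> B"
    then have "z \<in> vec.span A \<and> 0 \<in> vec.span B \<or> 0 \<in> vec.span A \<and> z \<in> vec.span B"
      using vec.span_base vec.span_zero by blast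
    moreover have "z = z + 0" "z = 0 + z" by simp_all
    ultimately show "z \<in> ?S" by blast
  qed
  then have "vec.dim (A \<union> B) \<le> vec.dim ?S"
    by (rule vec.dim_subset)
  also have "\<dots> \<le> vec.dim A + vec.dim B"
    using vec.dim_sums_Int[OF vec.subspace_span[of A] vec.subspace_span[of B]]
    unfolding vec.dim_span by linarith
  finally show ?thesis .
qed

lemma dim_Union_lines_le:
  assumes "finite \<sigma>" "\<sigma> \<subseteq> lines"
  shows "vec.dim (\<Union>\<sigma>) \<le> card \<sigma>"
  using assms
proof (induction \<sigma> rule: finite_induct)
  case empty
  then show ?case by simp
next
  case (insert L \<sigma>)
  then show ?case
    using dim_Un_le[of L "\<Union>\<sigma>"] by (simp add: lines_def)
qed

lemma abstract_simplicial_complex_K: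
  "abstract_simplicial_complex (K_complex :: ('f::field ^ 'n) set set set)"
  unfolding abstract_simplicial_complex_def
proof (intro ballI conjI allI impI)
  fix \<sigma> :: "('f ^ 'n) set set" assume \<sigma>: "\<sigma> \<in> K_complex"
  then show fin: "finite \<sigma>" and "\<sigma> \<noteq> {}"
    by (auto simp: K_complex_def)
  fix \<tau> assume \<tau>: "\<tau> \<subseteq> \<sigma>" "\<tau> \<noteq> {}"
  have lines: "\<sigma> \<subseteq> lines" and card: "vec.dim (\<Union>\<sigma>) = card \<sigma>"
    using \<sigma> by (auto simp: K_complex_def vec.dim_span)
  have fin': "finite \<tau>" "finite (\<sigma> - \<tau>)"
    using fin \<tau> finite_subset by auto
  have "\<Union>\<sigma> = \<Union>\<tau> \<union> \<Union>(\<sigma> - \<tau>)"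
    using \<tau> by blast
  then have "vec.dim (\<Union>\<sigma>) \<le> vec.dim (\<Union>\<tau>) + vec.dim (\<Union>(\<sigma> - \<tau>))"
    using dim_Un_le by metis
  also have "\<dots> \<le> vec.dim (\<Union>\<tau>) + card (\<sigma> - \<tau>)"
    using dim_Union_lines_le[of "\<sigma> - \<tau>"] fin' lines by auto
  finally have "card \<sigma> \<le> vec.dim (\<Union>\<tau>) + card (\<sigma> - \<tau>)"
    by (simp add: card)
  moreover have "card \<sigma> = card \<tau> + card (\<sigma> - \<tau>)"
    using \<tau> fin fin' by (metis card_Diff_subset card_mono le_add_diff_inverse)
  moreover have "vec.dim (\<Union>\<tau>) \<le> card \<tau>"
    using dim_Union_lines_le[of \<tau>] fin' lines \<tau> by auto
  ultimately show "\<tau> \<in> K_complex"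
    using fin' lines \<tau> by (auto simp: K_complex_def vec.dim_span)
qed


section \<open>Wedges of pointed spaces\<close>

text \<open>
  The wedge of the pointed spaces \<open>(X i, b i)\<close>, \<open>i \<in> I\<close>, with the quotient topology:
  \<open>None\<close> is the common base point, and \<open>Some (i, x)\<close> is the point \<open>x \<noteq> b i\<close> of the summand \<open>X i\<close>.
  The wedge over the empty index set is a single point.
\<close>

definition wedge_inclusion :: "('i \<Rightarrow> 'a) \<Rightarrow> 'i \<Rightarrow> 'a \<Rightarrow> ('i \<times> 'a) option" where
  "wedge_inclusion b i x = (if x = b i then None else Some (i, x))"

definition wedge_points :: "('i \<Rightarrow> 'a topology) \<Rightarrow> ('i \<Rightarrow> 'a) \<Rightarrow> 'i set \<Rightarrow> ('i \<times> 'a) option set" where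
  "wedge_points X b I = insert None (\<Union>i\<in>I. wedge_inclusion b i ` topspace (X i))"

definition wedge :: "('i \<Rightarrow> 'a topology) \<Rightarrow> ('i \<Rightarrow> 'a) \<Rightarrow> 'i set \<Rightarrow> ('i \<times> 'a) option topology" where
  "wedge X b I = topology (\<lambda>U. U \<subseteq> wedge_points X b I \<and>
     (\<forall>i\<in>I. openin (X i) {x \<in> topspace (X i). wedge_inclusion b i x \<in> U}))"

lemma istopology_wedge:
  "istopology (\<lambda>U. U \<subseteq> wedge_points X b I \<and>
     (\<forall>i\<in>I. openin (X i) {x \<in> topspace (X i). wedge_inclusion b i x \<in> U}))"
proof -
  have 1: "{x \<in> topspace (X i). wedge_inclusion b i x \<in> S \<inter> T} =
      {x \<in> topspace (X i). wedge_inclusion b i x \<in> S} \<inter>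
      {x \<in> topspace (X i). wedge_inclusion b i x \<in> T}" for S T i
    by auto
  have 2: "{x \<in> topspace (X i). wedge_inclusion b i x \<in> \<Union>\<K>} =
      (\<Union>S\<in>\<K>. {x \<in> topspace (X i). wedge_inclusion b i x \<in> S})" for \<K> i
    by auto
  show ?thesis
    unfolding istopology_def 1 2 by blast
qed

lemma openin_wedge:
  "openin (wedge X b I) U \<longleftrightarrow> U \<subseteq> wedge_points X b I \<and>
     (\<forall>i\<in>I. openin (X i) {x \<in> topspace (X i). wedge_inclusion b i x \<in> U})"
  by (simp add: wedge_def istopology_wedge)

lemma topspace_wedge [simp]: "topspace (wedge X b I) = wedge_points X b I"
proof -
  have "{x \<in> topspace (X i). wedge_inclusion b i x \<in> wedge_points X b I} = topspace (X i)"
    if "i \<in> I" for i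
    using that by (auto simp: wedge_points_def)
  then have "openin (wedge X b I) (wedge_points X b I)"
    by (simp add: openin_wedge)
  then show ?thesis
    by (meson openin_subset openin_topspace openin_wedge subset_antisym)
qed

lemma quotient_map_wedge:
  assumes "I \<noteq> {}" and "\<And>i. i \<in> I \<Longrightarrow> b i \<in> topspace (X i)"
  shows "quotient_map (sum_topology X I) (wedge X b I) (\<lambda>(i, x). wedge_inclusion b i x)"
proof -
  obtain i0 where "i0 \<in> I" using assms by blast
  then have "None = wedge_inclusion b i0 (b i0)" "b i0 \<in> topspace (X i0)"
    using assms by (auto simp: wedge_inclusion_def)
  then have surj: "(\<lambda>(i, x). wedge_inclusion b i x) ` Sigma I (topspace \<circ> X) = wedge_points X b I"
    using \<open>i0 \<in> I\<close> by (force simp: wedge_points_def)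
  show ?thesis
    unfolding quotient_map_def topspace_wedge topspace_sum_topology
    using surj
    by (auto simp: openin_sum_topology openin_wedge subset_iff
        cong: conj_cong Collect_cong ball_cong)
qed

definition wedge_of_spheres :: "nat \<Rightarrow> nat \<Rightarrow> (nat \<times> (nat \<Rightarrow> real)) option topology" where
  "wedge_of_spheres m d =
     wedge (\<lambda>_. nsphere d) (\<lambda>_ k. if k = 0 then 1 else 0) {..<m}"


section \<open>The numbers of spheres\<close>

definition A_number :: "nat \<Rightarrow> nat \<Rightarrow> real" where
  "A_number n p = (-1) ^ n +
     (\<Sum>i = 0..n - 1. (-1) ^ (n - 1 - i) *
        ((\<Prod>j = 0..i. real p ^ n - real p ^ j) / fact (i + 1)))"

definition B_number :: "nat \<Rightarrow> nat \<Rightarrow> real" where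
  "B_number n p = (-1) ^ n +
     (\<Sum>i = 0..n - 1. (-1) ^ (n - 1 - i) *
        ((\<Prod>j = 0..i. real p ^ n - real p ^ j) / ((real p - 1) ^ (i + 1) * fact (i + 1))))"

end

theory Submission
  imports Defs
begin

text \<open>
  A nonempty set of vectors is a simplex of \<open>X_complex\<close> if it is linearly independent, and a nonempty set of
  lines is a simplex of \<open>K_complex\<close> if its lines are in direct sum. Both notions of independence are matroids of
  rank \<open>n\<close>, and the complex of nonempty independent sets of any matroid of rank \<open>r > 0\<close> is a wedge
  of spheres of dimension \<open>r - 1\<close>. The reason is that matroid complexes are shellable.

  Order the bases by decreasing weight, where the weight of a set of elements is the number whose
  binary digits are its characteristic function. A face of a base \<open>B\<close> lies in no heavier base
  exactly when it contains the internally passive part \<open>R\<close> of \<open>B\<close>, the set of those elements that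
  can be exchanged for a larger one. Hence every independent set lies in exactly one of the
  intervals between such an \<open>R\<close> and its \<open>B\<close>. The intervals with \<open>R = B\<close> consist of a single facet;
  these bases are called critical. Remove the critical bases. The rest is built from
  the simplex on the heaviest base by adding intervals with \<open>{} \<noteq> R \<subset> B\<close>, and each such step can be
  undone by a deformation that pushes points off \<open>R\<close> towards a vertex in \<open>B - R\<close>
  (\<open>contractible_interval_expansion\<close>), so it is a contractible subcomplex.

  A contractible subcomplex may be collapsed to a point without changing the homotopy type
  (\<open>quotient_by_contractible\<close>). Each critical base then becomes a simplex whose whole boundary is
  one point, which is a sphere, and the quotient is the wedge of these spheres
  (\<open>homotopy_equivalent_wedge_of_spheres\<close>).

  The number of critical bases is an Euler characteristic: the alternating sum of \<open>(-1) ^ card \<sigma>\<close>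
  vanishes over an interval unless \<open>R = B\<close>. It remains to count independent sets of each size. In
  both matroids the number of ways to extend an independent set depends only on its size \<open>k\<close>: it is
  \<open>p ^ n - p ^ k\<close> for vectors, and this number divided by \<open>p - 1\<close> for lines. Counting
  pairs of an independent set and one of its elements gives the products over factorials in
  \<open>A_number\<close> and \<open>B_number\<close>.
\<close>

section \<open>Collapsing a contractible subspace, and wedges\<close>

text \<open>
  The homotopy extension property of the pair, applied to the identity of \<open>C\<close> and a contraction
  of \<open>A\<close>. The extended homotopy does not leave \<open>A\<close> on \<open>A\<close>, because there it is the contraction;
  that is what lets it pass to the quotient by \<open>A\<close>. The identity and the contraction define a map on
  \<open>{0} \<times> C \<union> {0..1} \<times> A\<close>, which extends to a neighbourhood because \<open>C\<close> is an ANR. A Urysohn function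
  slows the time down so that the homotopy stays in that neighbourhood.
\<close>

lemma homotopy_extension_contraction:
  fixes C A :: "'a::euclidean_space set"
  assumes "ANR C" "compact C" "closed A" "A \<subseteq> C" "contractible A" "A \<noteq> {}"
  obtains h c where "continuous_on ({0..1::real} \<times> C) h" "h \<in> {0..1} \<times> C \<rightarrow> C"
    "\<And>x. x \<in> C \<Longrightarrow> h (0, x) = x"
    "\<And>t x. t \<in> {0..1} \<Longrightarrow> x \<in> A \<Longrightarrow> h (t, x) \<in> A"
    "\<And>x. x \<in> A \<Longrightarrow> h (1, x) = c"
proof -
  obtain c where "homotopic_with_canon (\<lambda>x. True) A A id (\<lambda>x. c)"
    using assms by (auto simp: contractible_def)
  then obtain H where H: "continuous_on ({0..1::real} \<times> A) H" "H \<in> {0..1} \<times> A \<rightarrow> A"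
    and H0 [simp]: "\<And>x. H (0, x) = x" and H1 [simp]: "\<And>x. H (1, x) = c"
    by (fastforce simp: homotopic_with_def)
  define B where "B = {0..1::real} \<times> A \<union> {0} \<times> C"
  define \<phi> where "\<phi> z = (if snd z \<in> A then H z else snd z)" for z :: "real \<times> 'a"
  have clo: "closed ({0..1::real} \<times> A)" "closed ({0::real} \<times> C)"
    using assms compact_imp_closed by (blast intro: closed_Times closed_atLeastAtMost closed_singleton)+
  have "continuous_on B \<phi>"
    unfolding B_def \<phi>_def
    by (rule continuous_on_cases_local)
       (use clo H in \<open>auto intro!: continuous_intros closed_subset\<close>)
  moreover have "\<phi> \<in> B \<rightarrow> C"
    using funcset_mem[OF H(2)] \<open>A \<subseteq> C\<close> by (fastforce simp: B_def \<phi>_def)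
  moreover have "closedin (top_of_set ({0..1} \<times> C)) B"
    using clo assms by (intro closed_subset) (auto simp: B_def)
  ultimately obtain V k where V: "B \<subseteq> V" "openin (top_of_set ({0..1} \<times> C)) V"
    and k: "continuous_on V k" "k \<in> V \<rightarrow> C" "\<And>x. x \<in> B \<Longrightarrow> k x = \<phi> x"
    using ANR_imp_absolute_neighbourhood_extensor[OF \<open>ANR C\<close>] by metis
  \<comment> \<open>The points of \<open>C\<close> whose whole time interval is not available in \<open>V\<close>.\<close>
  define S where "S = snd ` ({0..1} \<times> C - V)"
  have "closedin (top_of_set ({0..1} \<times> C)) ({0..1} \<times> C - V)"
    using V(2) by (intro closedin_diff closedin_self)
  then have "compact ({0..1} \<times> C - V)"
    by (rule closedin_compact[OF compact_Times[OF compact_Icc \<open>compact C\<close>]])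
  then have "closed S"
    unfolding S_def by (intro compact_imp_closed compact_continuous_image continuous_intros)
  have "A \<inter> S = {}"
    using V(1) by (auto simp: S_def B_def)
  then obtain a :: "'a \<Rightarrow> real" where a: "continuous_on UNIV a" "\<And>x. a x \<in> closed_segment 1 0"
    "\<And>x. x \<in> A \<Longrightarrow> a x = 1" "\<And>x. x \<in> S \<Longrightarrow> a x = 0"
    using Urysohn[OF \<open>closed A\<close> \<open>closed S\<close>] by metis
  have a01: "0 \<le> a x" "a x \<le> 1" for x
    using a(2)[of x] by (auto simp: closed_segment_eq_real_ivl split: if_splits)
  have inV: "(a x * t, x) \<in> V" if "x \<in> C" "t \<in> {0..1}" for x t
  proof (cases "x \<in> S")
    case True
    then show ?thesis using V(1) a(4) that by (auto simp: B_def)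
  next
    case False
    have "(a x * t, x) \<in> {0..1} \<times> C" using a01[of x] that by (auto intro: mult_le_one)
    then show ?thesis using False by (force simp: S_def)
  qed
  define h where "h z = k (a (snd z) * fst z, snd z)" for z
  show thesis
  proof
    show "continuous_on ({0..1} \<times> C) h"
      unfolding h_def
      by (rule continuous_on_compose2[OF k(1)])
         (use inV in \<open>auto intro!: continuous_intros continuous_on_compose2[OF a(1)]\<close>)
    show "h \<in> {0..1} \<times> C \<rightarrow> C"
      using inV k(2) by (auto simp: h_def)
    show "h (0, x) = x" if "x \<in> C" for x
      using k(3)[of "(0, x)"] that by (auto simp: h_def B_def \<phi>_def)
    show "h (t, x) \<in> A" if "t \<in> {0..1}" "x \<in> A" for t x
      using k(3)[of "(t, x)"] H(2) that a(3) by (auto simp: h_def B_def \<phi>_def)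
    show "h (1, x) = c" if "x \<in> A" for x
      using k(3)[of "(1, x)"] that a(3) by (auto simp: h_def B_def \<phi>_def)
  qed
qed

text \<open>
  The end \<open>h\<^sub>1\<close> of a homotopy as in \<open>homotopy_extension_contraction\<close> is constant on \<open>A\<close>, so it factors
  as \<open>g \<circ> q\<close>. This \<open>g\<close> is a homotopy inverse of \<open>q\<close>: the homotopy \<open>h\<close> joins \<open>g \<circ> q\<close> to the identity
  of \<open>C\<close>, and \<open>q \<circ> h\<close> descends to a homotopy of \<open>W\<close> that joins \<open>q \<circ> g\<close> to the identity. For the
  descent, the product of \<open>q\<close> with the unit interval must again be a quotient map; compactness of \<open>C\<close>
  and the Hausdorff property of \<open>W\<close> give this.
\<close>

lemma quotient_by_contractible:
  fixes C A :: "'a::euclidean_space set"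
  assumes C: "ANR C" "compact C" and A: "closed A" "A \<subseteq> C" "contractible A" "A \<noteq> {}"
    and W: "Hausdorff_space W"
    and q: "continuous_map (top_of_set C) W q" "q ` C = topspace W"
    and fibres: "\<And>x y. x \<in> C \<Longrightarrow> y \<in> C \<Longrightarrow> q x = q y \<longleftrightarrow> x = y \<or> x \<in> A \<and> y \<in> A"
  shows "top_of_set C homotopy_equivalent_space W"
proof -
  obtain h c where h: "continuous_on ({0..1::real} \<times> C) h" "h \<in> {0..1} \<times> C \<rightarrow> C"
    and h0: "\<And>x. x \<in> C \<Longrightarrow> h (0, x) = x"
    and hA: "\<And>t x. t \<in> {0..1} \<Longrightarrow> x \<in> A \<Longrightarrow> h (t, x) \<in> A"
    and h1: "\<And>x. x \<in> A \<Longrightarrow> h (1, x) = c"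
    using homotopy_extension_contraction[OF C A] by metis
  let ?I = "top_of_set {0..1::real}" and ?C = "top_of_set C"
  have hcont: "continuous_map (prod_topology ?I ?C) ?C h"
    using h by (simp add: image_subset_iff_funcset)
  have quot: "quotient_map ?C W q"
    using continuous_imp_quotient_map[OF q(1) _ W] q(2) \<open>compact C\<close> by (simp add: compact_space_subtopology)
  have hc1: "continuous_map ?C ?C (\<lambda>x. h (1, x))"
    using h by (auto intro!: continuous_on_compose2[OF h(1)] continuous_intros)
  have hq1: "h (1, x) = h (1, y)" if "x \<in> topspace ?C" "y \<in> topspace ?C" "q x = q y" for x y
  proof -
    have "x = y \<or> x \<in> A \<and> y \<in> A" using that fibres[of x y] by simp
    then show ?thesis using h1[of x] h1[of y] by metis
  qed
  obtain g where g: "continuous_map W ?C g" "\<And>x. x \<in> topspace ?C \<Longrightarrow> g (q x) = h (1, x)"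
    by (rule quotient_map_lift_exists[OF quot hc1]) (erule hq1, assumption+, rule that)
  have gq: "homotopic_with (\<lambda>x. True) ?C ?C (g \<circ> q) id"
  proof (rule homotopic_with_symD)
    show "homotopic_with (\<lambda>x. True) ?C ?C id (g \<circ> q)"
      unfolding homotopic_with_def
    proof (intro exI conjI allI)
      define h' where "h' z = (if snd z \<in> C then h z else if fst z = 0 then snd z else g (q (snd z)))" for z
      show "continuous_map (prod_topology ?I ?C) ?C h'"
        by (rule continuous_map_eq[OF hcont]) (auto simp: h'_def)
      show "h' (0, x) = id x" "h' (1, x) = (g \<circ> q) x" for x
        using h0 g(2) by (auto simp: h'_def)
    qed auto
  qed
  have QI: "quotient_map (prod_topology ?I ?C) (prod_topology ?I W) (\<lambda>(t, x). (t, q x))"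
  proof (rule continuous_imp_quotient_map)
    show "continuous_map (prod_topology ?I ?C) (prod_topology ?I W) (\<lambda>(t, x). (t, q x))"
      unfolding continuous_map_prod_top using q(1) by (intro disjI2 conjI continuous_map_id[unfolded id_def]) auto
    show "compact_space (prod_topology ?I ?C)"
      using \<open>compact C\<close>
      by (intro compact_space_prod_topology[THEN iffD2] disjI2 conjI compact_space_subtopology) auto
    show "Hausdorff_space (prod_topology ?I W)"
      using W by (simp add: Hausdorff_space_prod_topology Hausdorff_space_subtopology)
    show "(\<lambda>(t, x). (t, q x)) ` topspace (prod_topology ?I ?C) = topspace (prod_topology ?I W)"
      using q(2) by (auto simp: image_iff) (metis imageE)
  qed
  have qh: "continuous_map (prod_topology ?I ?C) W (q \<circ> h)"
    using hcont q(1) by (rule continuous_map_compose)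
  have qh_eq: "(q \<circ> h) z = (q \<circ> h) z'"
    if "z \<in> topspace (prod_topology ?I ?C)" "z' \<in> topspace (prod_topology ?I ?C)"
      "(\<lambda>(t, x). (t, q x)) z = (\<lambda>(t, x). (t, q x)) z'" for z z'
  proof -
    obtain t x t' y where "z = (t, x)" "z' = (t', y)" by fastforce
    then have z: "z = (t, x)" "z' = (t, y)" "q x = q y" "x \<in> C" "y \<in> C" "t \<in> {0..1}"
      using that by auto
    then have "x = y \<or> x \<in> A \<and> y \<in> A" using fibres[of x y] by metis
    then show ?thesis
      using fibres[of "h (t, x)" "h (t, y)"] hA[of t x] hA[of t y] A(2) z by auto
  qed
  obtain k where k: "continuous_map (prod_topology ?I W) W k"
    "\<And>z. z \<in> topspace (prod_topology ?I ?C) \<Longrightarrow> k ((\<lambda>(t, x). (t, q x)) z) = (q \<circ> h) z"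
    by (rule quotient_map_lift_exists[OF QI qh]) (erule qh_eq, assumption+, rule that)
  have kq: "k (t, q x) = q (h (t, x))" if "t \<in> {0..1}" "x \<in> C" for t x
    using k(2)[of "(t, x)"] that by simp
  have "homotopic_with (\<lambda>x. True) W W id (q \<circ> g)"
    unfolding homotopic_with_def
  proof (intro exI conjI allI)
    define k' where "k' z = (if snd z \<in> topspace W then k z else if fst z = 0 then snd z else q (g (snd z)))" for z
    show "continuous_map (prod_topology ?I W) W k'"
      by (rule continuous_map_eq[OF k(1)]) (auto simp: k'_def)
    show "k' (0, y) = id y" "k' (1, y) = (q \<circ> g) y" for y
    proof -
      have "k (0, y) = y \<and> k (1, y) = q (g y)" if y: "y \<in> topspace W"
      proof -
        obtain x where "x \<in> C" "y = q x" using y q(2) by blast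
        then show ?thesis using kq[of 0 x] kq[of 1 x] h0[of x] g(2)[of x] by simp
      qed
      then show "k' (0, y) = id y" "k' (1, y) = (q \<circ> g) y"
        by (auto simp: k'_def)
    qed
  qed auto
  then show ?thesis
    unfolding homotopy_equivalent_space_def
    using g(1) q(1) gq homotopic_with_symD[OF \<open>homotopic_with _ W W id _\<close>] by blast
qed

lemma continuous_map_wedge_inclusion:
  assumes "i \<in> I"
  shows "continuous_map (X i) (wedge X b I) (wedge_inclusion b i)"
  unfolding continuous_map_def
  using assms by (auto simp: wedge_points_def openin_wedge)

text \<open>
  The retractions \<open>r i\<close> of the wedge onto its summands, collapsing all others to the base point, are
  continuous and together separate points.
\<close>

lemma Hausdorff_space_wedge:
  assumes "\<And>i. i \<in> I \<Longrightarrow> Hausdorff_space (X i)" and "\<And>i. i \<in> I \<Longrightarrow> b i \<in> topspace (X i)"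
  shows "Hausdorff_space (wedge X b I)"
proof -
  define r where "r i p = (case p of Some (j, x) \<Rightarrow> if j = i then x else b i | None \<Rightarrow> b i)"
    for i and p :: "('a \<times> 'b) option"
  have r_incl: "r i (wedge_inclusion b j x) = (if j = i then x else b i)" for i j x
    by (auto simp: r_def wedge_inclusion_def)
  have rcont: "continuous_map (wedge X b I) (X i) (r i)" if "i \<in> I" for i
    unfolding continuous_map_def
  proof (intro conjI allI impI)
    show "r i \<in> topspace (wedge X b I) \<rightarrow> topspace (X i)"
      using that assms by (auto simp: wedge_points_def r_incl) (auto simp: r_def)
    fix U assume U: "openin (X i) U"
    have "openin (X j) {x \<in> topspace (X j). wedge_inclusion b j x \<in> {p \<in> topspace (wedge X b I). r i p \<in> U}}"
      if j: "j \<in> I" for j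
    proof -
      have "{x \<in> topspace (X j). wedge_inclusion b j x \<in> {p \<in> topspace (wedge X b I). r i p \<in> U}}
        = (if j = i then U else if b i \<in> U then topspace (X j) else {})"
        using j openin_subset[OF U] by (auto simp: r_incl wedge_points_def)
      then show ?thesis using U by auto
    qed
    then show "openin (wedge X b I) {p \<in> topspace (wedge X b I). r i p \<in> U}"
      by (auto simp: openin_wedge)
  qed
  have sep: "\<exists>i\<in>I. r i p \<noteq> r i p'"
    if "p \<in> wedge_points X b I" "p' \<in> wedge_points X b I" "p \<noteq> p'" for p p'
    using that by (fastforce simp: wedge_points_def wedge_inclusion_def r_def split: if_splits)
  show ?thesis
    unfolding Hausdorff_space_def
  proof (intro allI impI, elim conjE)
    fix p p' assume p: "p \<in> topspace (wedge X b I)" "p' \<in> topspace (wedge X b I)" "p \<noteq> p'"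
    then obtain i where i: "i \<in> I" "r i p \<noteq> r i p'" using sep by auto
    then obtain U V where UV: "openin (X i) U" "openin (X i) V" "r i p \<in> U" "r i p' \<in> V" "disjnt U V"
      using assms(1)[OF i(1)] rcont[OF i(1)] p
      unfolding Hausdorff_space_def continuous_map_def Pi_iff by metis
    let ?W = "topspace (wedge X b I)"
    show "\<exists>U V. openin (wedge X b I) U \<and> openin (wedge X b I) V \<and> p \<in> U \<and> p' \<in> V \<and> disjnt U V"
      using openin_continuous_map_preimage[OF rcont[OF i(1)] UV(1)]
        openin_continuous_map_preimage[OF rcont[OF i(1)] UV(2)] UV(3-5) p
      by (intro exI[of _ "{x \<in> ?W. r i x \<in> U}"] exI[of _ "{x \<in> ?W. r i x \<in> V}"])
         (auto simp: disjnt_iff)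
  qed
qed

section \<open>Realisations of finite complexes\<close>

definition support :: "real ^ 'v \<Rightarrow> 'v set" where
  "support x = {v. x $ v \<noteq> 0}"

definition simplex_on :: "'v::finite set \<Rightarrow> (real ^ 'v) set" where
  "simplex_on \<sigma> = {x. (\<forall>v. 0 \<le> x $ v) \<and> (\<Sum>v\<in>UNIV. x $ v) = 1 \<and> support x \<subseteq> \<sigma>}"

lemma convex_hull_axes: "convex hull ((\<lambda>v. axis v 1) ` \<sigma>) = simplex_on (\<sigma> :: 'v::finite set)"
proof
  have "convex (simplex_on \<sigma>)"
  proof (rule convexI)
    fix x y :: "real^'v" and a b :: real
    assume *: "x \<in> simplex_on \<sigma>" "y \<in> simplex_on \<sigma>" "0 \<le> a" "0 \<le> b" "a + b = 1"
    then have "(\<Sum>v\<in>UNIV. (a *\<^sub>R x + b *\<^sub>R y) $ v) = 1"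
      by (simp add: simplex_on_def sum.distrib flip: sum_distrib_left)
    moreover have "support (a *\<^sub>R x + b *\<^sub>R y) \<subseteq> support x \<union> support y"
      by (auto simp: support_def)
    ultimately show "a *\<^sub>R x + b *\<^sub>R y \<in> simplex_on \<sigma>"
      using * by (auto simp: simplex_on_def)
  qed
  moreover have "axis v 1 \<in> simplex_on \<sigma>" if "v \<in> \<sigma>" for v
    using that by (auto simp: simplex_on_def support_def axis_def)
  ultimately show "convex hull ((\<lambda>v. axis v 1) ` \<sigma>) \<subseteq> simplex_on \<sigma>"
    by (intro hull_minimal) auto
next
  show "simplex_on \<sigma> \<subseteq> convex hull ((\<lambda>v. axis v 1) ` \<sigma>)"
  proof
    fix x assume x: "x \<in> simplex_on \<sigma>"
    then have z: "x $ v = 0" if "v \<notin> \<sigma>" for v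
      using that by (auto simp: simplex_on_def support_def)
    have "x = (\<Sum>v\<in>UNIV. x $ v *\<^sub>R axis v 1)"
      by (simp add: vec_eq_iff axis_def if_distrib[of "\<lambda>x. _ * x"] cong: if_cong)
    also have "\<dots> = (\<Sum>v\<in>\<sigma>. x $ v *\<^sub>R axis v 1)"
      by (rule sum.mono_neutral_right) (use z in auto)
    also have "\<dots> \<in> convex hull ((\<lambda>v. axis v 1) ` \<sigma>)"
    proof (rule convex_sum)
      have "(\<Sum>v\<in>\<sigma>. x $ v) = (\<Sum>v\<in>UNIV. x $ v)"
        by (rule sum.mono_neutral_left) (use z in auto)
      then show "(\<Sum>v\<in>\<sigma>. x $ v) = 1"
        using x by (simp add: simplex_on_def)
    qed (use x in \<open>auto simp: simplex_on_def hull_inc\<close>)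
    finally show "x \<in> convex hull ((\<lambda>v. axis v 1) ` \<sigma>)" .
  qed
qed

lemma simplicial_complex_face:
  "abstract_simplicial_complex K \<Longrightarrow> \<sigma> \<in> K \<Longrightarrow> \<tau> \<subseteq> \<sigma> \<Longrightarrow> \<tau> \<noteq> {} \<Longrightarrow> \<tau> \<in> K"
  unfolding abstract_simplicial_complex_def by blast

lemma geometric_realisation_simplices: "geometric_realisation K = \<Union>(simplex_on ` K)"
  by (simp add: geometric_realisation_def convex_hull_axes)

lemma support_nonempty: "(\<Sum>v\<in>UNIV. x $ v) = (1::real) \<Longrightarrow> support x \<noteq> {}"
  unfolding support_def using sum.neutral[of UNIV "\<lambda>v. x $ v"] by fastforce

text \<open>
  Points of the realisation are described by barycentric coordinates; membership in the complex is
  tested on the support alone, because faces of simplices are simplices.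
\<close>

lemma in_geometric_realisation_iff:
  assumes "abstract_simplicial_complex K"
  shows "x \<in> geometric_realisation K \<longleftrightarrow>
    (\<forall>v. 0 \<le> x $ v) \<and> (\<Sum>v\<in>UNIV. x $ v) = 1 \<and> support x \<in> K"
  using assms support_nonempty[of x]
  by (auto simp: geometric_realisation_simplices simplex_on_def abstract_simplicial_complex_def)

lemma compact_simplex_on: "compact (simplex_on \<sigma>)" and convex_simplex_on: "convex (simplex_on \<sigma>)"
  unfolding convex_hull_axes[symmetric]
  by (simp_all add: compact_convex_hull finite_imp_compact)

lemma compact_geometric_realisation: "compact (geometric_realisation K)"
  by (auto simp: geometric_realisation_simplices intro!: compact_Union compact_simplex_on)

lemma ANR_geometric_realisation: "ANR (geometric_realisation K)"
  unfolding geometric_realisation_simplices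
  by (rule ANR_finite_Union_convex_closed)
     (auto simp: convex_simplex_on compact_imp_closed compact_simplex_on)

lemma continuous_on_Min:
  fixes f :: "'i \<Rightarrow> 'a::topological_space \<Rightarrow> 'b::linorder_topology"
  assumes "finite I" "I \<noteq> {}" "\<And>i. i \<in> I \<Longrightarrow> continuous_on S (f i)"
  shows "continuous_on S (\<lambda>x. Min ((\<lambda>i. f i x) ` I))"
  using assms by (induction rule: finite_ne_induct) (auto intro!: continuous_on_min)

text \<open>
  The interval between \<open>R\<close> and \<open>B\<close> can be collapsed. Fix a vertex \<open>w \<in> B - R\<close> and let \<open>t x\<close> be the
  smallest coordinate of \<open>x\<close> in \<open>R\<close>. Subtracting \<open>t x\<close> from all coordinates in \<open>R\<close> and adding the
  lost mass to the coordinate of \<open>w\<close> makes some coordinate in \<open>R\<close> vanish, so it retracts the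
  realisation of \<open>K\<close> to that of \<open>L\<close>. A point moves only if its support contains \<open>R\<close>, and
  then the segment along which it moves lies in the simplex on \<open>B\<close>.
\<close>

lemma contractible_interval_expansion:
  fixes K L :: "'v::finite set set"
  assumes asc: "abstract_simplicial_complex K" "abstract_simplicial_complex L"
    and K: "K = L \<union> {\<sigma>. R \<subseteq> \<sigma> \<and> \<sigma> \<subseteq> B}" and R: "R \<noteq> {}" "R \<subset> B" "R \<notin> L"
    and contr: "contractible (geometric_realisation L)"
  shows "contractible (geometric_realisation K)"
proof -
  let ?K = "geometric_realisation K" and ?L = "geometric_realisation L"
  obtain w where w: "w \<in> B" "w \<notin> R" using R by blast
  define t :: "real^'v \<Rightarrow> real" where "t x = Min ((\<lambda>u. x $ u) ` R)" for x
  define r :: "real^'v \<Rightarrow> real^'v" where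
    "r x = (\<chi> v. if v = w then x $ v + card R * t x else if v \<in> R then x $ v - t x else x $ v)" for x
  have mem: "\<sigma> \<in> K \<longleftrightarrow> \<sigma> \<in> L \<or> R \<subseteq> \<sigma> \<and> \<sigma> \<subseteq> B" for \<sigma>
    unfolding K by simp
  have BK: "B \<in> K" using R unfolding mem by blast
  have L_R: "\<not> R \<subseteq> \<sigma>" if "\<sigma> \<in> L" for \<sigma>
    using that asc(2) R by (auto simp: abstract_simplicial_complex_def)
  have t_le: "t x \<le> x $ u" if "u \<in> R" for x u
    using that by (auto simp: t_def)
  have t_attained: "\<exists>u\<in>R. x $ u = t x" for x
  proof -
    have "t x \<in> (\<lambda>u. x $ u) ` R" unfolding t_def using R(1) by (intro Min_in) auto
    then show ?thesis by auto
  qed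
  have faces: "\<tau> \<in> L" if "\<tau> \<subseteq> B" "\<tau> \<noteq> {}" "\<not> R \<subseteq> \<tau>" for \<tau>
  proof -
    have "\<tau> \<in> K" using simplicial_complex_face[OF asc(1) BK] that by blast
    then show ?thesis using that(3) unfolding mem by blast
  qed
  have cont_t: "continuous_on S t" for S
    unfolding t_def[abs_def] by (rule continuous_on_Min) (use R in \<open>auto intro!: continuous_intros\<close>)
  have cont_r: "continuous_on S r" for S
    unfolding r_def[abs_def]
  proof (rule continuous_on_vec_lambda)
    fix v
    show "continuous_on S (\<lambda>x. if v = w then x $ v + card R * t x else if v \<in> R then x $ v - t x else x $ v)"
      by (cases "v = w"; cases "v \<in> R") (auto intro!: continuous_intros cont_t)
  qed
  have r_in: "r x \<in> ?L \<and> (support x \<subseteq> B \<and> t x > 0 \<or> r x = x)" if x: "x \<in> ?K" for x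
  proof -
    have x0: "0 \<le> x $ v" and x1: "(\<Sum>v\<in>UNIV. x $ v) = 1" and xs: "support x \<in> K" for v
      using x by (auto simp: in_geometric_realisation_iff[OF asc(1)])
    obtain u where u: "u \<in> R" "x $ u = t x" using t_attained by blast
    have t0: "0 \<le> t x" using u x0 by metis
    show ?thesis
    proof (cases "R \<subseteq> support x")
      case False
      then obtain u' where "u' \<in> R" "x $ u' = 0" by (auto simp: support_def)
      then have "t x = 0" using t0 t_le by (metis order_antisym)
      then have "r x = x" by (simp add: r_def vec_eq_iff)
      moreover have "support x \<in> L" using False xs unfolding mem by blast
      ultimately show ?thesis by (simp add: in_geometric_realisation_iff[OF asc(2)] x0 x1)
    next
      case True
      then have sB: "support x \<subseteq> B" using xs L_R unfolding mem by blast
      have t1: "t x > 0" using True u t0 by (force simp: support_def)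
      have "(\<Sum>v\<in>UNIV. r x $ v) = (\<Sum>v\<in>UNIV. x $ v + ((if v = w then card R * t x else 0) - (if v \<in> R then t x else 0)))"
        using w by (intro sum.cong) (auto simp: r_def)
      also have "\<dots> = 1"
        by (simp add: sum.distrib sum_subtractf x1 sum.If_cases)
      finally have r1: "(\<Sum>v\<in>UNIV. r x $ v) = 1" .
      have r0: "0 \<le> r x $ v" for v
        using x0 t0 t_le by (auto simp: r_def)
      have "r x $ u = 0" using u w by (auto simp: r_def)
      then have "\<not> R \<subseteq> support (r x)" using u by (auto simp: support_def)
      moreover have "support (r x) \<subseteq> B"
        using sB w R by (auto simp: support_def r_def split: if_splits)
      ultimately have "support (r x) \<in> L"
        using faces support_nonempty[OF r1] by blast
      then show ?thesis
        using sB t1 r0 r1 by (simp add: in_geometric_realisation_iff[OF asc(2)])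
    qed
  qed
  have LK: "?L \<subseteq> ?K" using mem by (auto simp: geometric_realisation_def)
  have "homotopic_with_canon (\<lambda>x. True) ?K ?K id r"
  proof (rule homotopic_with_linear)
    fix x assume x: "x \<in> ?K"
    show "closed_segment (id x) (r x) \<subseteq> ?K"
    proof (cases "r x = x")
      case True
      then show ?thesis using x by simp
    next
      case False
      then have sB: "support x \<subseteq> B" using r_in[OF x] by blast
      then have "x \<in> simplex_on B" "r x \<in> simplex_on B"
        using r_in[OF x] x w R unfolding in_geometric_realisation_iff[OF asc(1)] in_geometric_realisation_iff[OF asc(2)]
        by (auto simp: simplex_on_def support_def r_def split: if_splits)
      then have "closed_segment (id x) (r x) \<subseteq> simplex_on B"
        using convex_simplex_on by (metis closed_segment_subset id_apply)
      then show ?thesis using BK by (auto simp: geometric_realisation_simplices)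
    qed
  qed (auto intro: cont_r continuous_on_id)
  moreover obtain c where "homotopic_with_canon (\<lambda>x. True) ?L ?L id (\<lambda>x. c)"
    using contr by (auto simp: contractible_def)
  then have "homotopic_with_canon (\<lambda>x. True) ?L ?K id (\<lambda>x. c)"
    using LK by (rule homotopic_with_subset_right)
  then have "homotopic_with_canon (\<lambda>x. True) ?K ?K (id \<circ> r) ((\<lambda>x. c) \<circ> r)"
    by (rule homotopic_with_compose_continuous_map_right) (use r_in cont_r in auto)
  then have "homotopic_with_canon (\<lambda>x. True) ?K ?K r (\<lambda>x. c)"
    by (simp add: o_def)
  ultimately have "homotopic_with_canon (\<lambda>x. True) ?K ?K id (\<lambda>x. c)"
    by (rule homotopic_with_trans)
  then show ?thesis
    unfolding contractible_def by blast
qed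

section \<open>A simplex modulo its boundary is a sphere\<close>

definition standard_simplex :: "nat \<Rightarrow> (nat \<Rightarrow> real) set" where
  "standard_simplex d = {u. (\<forall>i\<le>d. 0 \<le> u i) \<and> (\<Sum>i\<le>d. u i) = 1}"

text \<open>
  Scaled so that the depth is 1 at the barycentre; it is 0 exactly on the boundary.
\<close>

definition simplex_depth :: "nat \<Rightarrow> (nat \<Rightarrow> real) \<Rightarrow> real" where
  "simplex_depth d u = real (Suc d) * Min (u ` {..d})"

text \<open>
  The squared length of the offset from the barycentre, with coordinate 0 omitted. The omitted
  coordinate is determined by the others, which therefore are \<open>d\<close> free coordinates.
\<close>

definition offset_square :: "nat \<Rightarrow> (nat \<Rightarrow> real) \<Rightarrow> real" where
  "offset_square d u = (\<Sum>i = 1..d. (u i - 1 / real (Suc d)) ^ 2)"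

text \<open>
  In the interior, where \<open>t > 0\<close>, the offset from the barycentre divided by \<open>t\<close> identifies the open
  simplex with Euclidean space, since rays from the barycentre are stretched to infinite length. The
  formula below is the inverse stereographic projection of that vector, with denominators cleared;
  in this form it is continuous up to the boundary \<open>t = 0\<close>, which goes to the centre of
  projection \<open>(1, 0, \<dots>, 0)\<close>.
\<close>

definition simplex_to_sphere :: "nat \<Rightarrow> (nat \<Rightarrow> real) \<Rightarrow> nat \<Rightarrow> real" where
  "simplex_to_sphere d u i =
    (let t = simplex_depth d u; S = offset_square d u in
     if i = 0 then (S - t\<^sup>2) / (S + t\<^sup>2)
     else if i \<le> d then 2 * t * (u i - 1 / real (Suc d)) / (S + t\<^sup>2)
     else 0)"

definition sphere_base :: "nat \<Rightarrow> real" where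
  "sphere_base k = (if k = 0 then 1 else 0)"

lemma sum_split_0: "(\<Sum>i\<le>d. f i) = f 0 + (\<Sum>i = 1..d. f i :: real)" for d :: nat
  using sum.atLeast_Suc_atMost[of 0 d f] by (simp add: atLeast0AtMost)

lemma simplex_depth_le: "i \<le> d \<Longrightarrow> simplex_depth d u \<le> real (Suc d) * u i"
  unfolding simplex_depth_def by (intro mult_left_mono Min_le) auto

lemma simplex_depth_attained: "\<exists>i\<le>d. simplex_depth d u = real (Suc d) * u i"
proof -
  have "Min (u ` {..d}) \<in> u ` {..d}" by (intro Min_in) auto
  then obtain i where "i \<le> d" "Min (u ` {..d}) = u i" by blast
  then show ?thesis by (metis simplex_depth_def)
qed

lemma simplex_depth_nonneg: "u \<in> standard_simplex d \<Longrightarrow> 0 \<le> simplex_depth d u"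
  using simplex_depth_attained[of d u] by (auto simp: standard_simplex_def)

lemma simplex_depth_0_iff:
  assumes "u \<in> standard_simplex d"
  shows "simplex_depth d u = 0 \<longleftrightarrow> (\<exists>i\<le>d. u i = 0)"
proof
  assume "simplex_depth d u = 0"
  then show "\<exists>i\<le>d. u i = 0" using simplex_depth_attained[of d u] by auto
next
  assume "\<exists>i\<le>d. u i = 0"
  then show "simplex_depth d u = 0"
    using simplex_depth_le[of _ d u] simplex_depth_nonneg[OF assms] by fastforce
qed

lemma offset_square_nonneg: "0 \<le> offset_square d u"
  by (simp add: offset_square_def sum_nonneg)

text \<open>
  The two summands do not vanish together: only the barycentre has offset 0, and it has depth 1.
\<close>

lemma denominator_pos:
  assumes u: "u \<in> standard_simplex d"
  shows "0 < offset_square d u + (simplex_depth d u)\<^sup>2"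
proof (rule ccontr)
  assume "\<not> ?thesis"
  then have S: "offset_square d u = 0" and "(simplex_depth d u)\<^sup>2 = 0"
    using offset_square_nonneg[of d u] zero_le_power2[of "simplex_depth d u"] by linarith+
  then have t: "simplex_depth d u = 0" by simp
  have *: "u i = 1 / real (Suc d)" if "i \<in> {1..d}" for i
    using S that by (simp add: offset_square_def sum_nonneg_eq_0_iff)
  have "u 0 + real d * (1 / real (Suc d)) = 1"
    using u * by (simp add: standard_simplex_def sum_split_0)
  then have "u 0 = 1 / real (Suc d)"
    by (simp add: field_simps)
  then have "u i > 0" if "i \<le> d" for i
    using *[of i] that by (cases "i = 0") auto
  then show False
    using t simplex_depth_0_iff[OF u] by force
qed

lemma simplex_to_sphere_in:
  assumes u: "u \<in> standard_simplex d"
  shows "simplex_to_sphere d u \<in> topspace (nsphere d)"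
proof -
  let ?t = "simplex_depth d u" and ?S = "offset_square d u"
  define D where "D = ?S + ?t\<^sup>2"
  have D: "D > 0" using denominator_pos[OF u] by (simp add: D_def)
  have "(\<Sum>i = 1..d. (simplex_to_sphere d u i)\<^sup>2)
    = (\<Sum>i = 1..d. (2 * ?t / D)\<^sup>2 * (u i - 1 / real (Suc d))\<^sup>2)"
    by (intro sum.cong) (auto simp: simplex_to_sphere_def D_def Let_def power_mult_distrib power_divide)
  also have "\<dots> = (2 * ?t / D)\<^sup>2 * ?S"
    by (simp add: offset_square_def sum_distrib_left)
  finally have "(\<Sum>i\<le>d. (simplex_to_sphere d u i)\<^sup>2) = ((?S - ?t\<^sup>2) / D)\<^sup>2 + (2 * ?t / D)\<^sup>2 * ?S"
    unfolding sum_split_0 by (simp add: simplex_to_sphere_def D_def Let_def)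
  also have "\<dots> = ((?S - ?t\<^sup>2)\<^sup>2 + 4 * ?t\<^sup>2 * ?S) / D\<^sup>2"
    by (simp add: power_divide power_mult_distrib add_divide_distrib)
  also have "(?S - ?t\<^sup>2)\<^sup>2 + 4 * ?t\<^sup>2 * ?S = D\<^sup>2"
    by (simp add: D_def power2_eq_square algebra_simps)
  finally have "(\<Sum>i\<le>d. (simplex_to_sphere d u i)\<^sup>2) = 1"
    using D by simp
  then show ?thesis
    by (auto simp: nsphere simplex_to_sphere_def)
qed

lemma simplex_to_sphere_base:
  assumes u: "u \<in> standard_simplex d"
  shows "simplex_to_sphere d u = sphere_base \<longleftrightarrow> simplex_depth d u = 0"
proof
  assume "simplex_to_sphere d u = sphere_base"
  then have "simplex_to_sphere d u 0 = 1" by (simp add: sphere_base_def)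
  then show "simplex_depth d u = 0"
    using denominator_pos[OF u] by (auto simp: simplex_to_sphere_def Let_def split: if_splits)
next
  assume "simplex_depth d u = 0"
  then show "simplex_to_sphere d u = sphere_base"
    using denominator_pos[OF u] by (auto simp: simplex_to_sphere_def sphere_base_def)
qed

text \<open>
  Stereographic projection of the image recovers the offset divided by the depth.
\<close>

lemma simplex_to_sphere_scaled:
  assumes u: "u \<in> standard_simplex d" and t: "simplex_depth d u > 0" and i: "i \<in> {1..d}"
  shows "u i - 1 / real (Suc d) =
    simplex_depth d u * (simplex_to_sphere d u i / (1 - simplex_to_sphere d u 0))"
proof -
  let ?t = "simplex_depth d u" and ?S = "offset_square d u"
  define D where "D = ?S + ?t\<^sup>2"
  have D: "D > 0" using denominator_pos[OF u] by (simp add: D_def)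
  have "1 - simplex_to_sphere d u 0 = 2 * ?t\<^sup>2 / D"
    using D by (simp add: simplex_to_sphere_def D_def[symmetric] field_simps)
  moreover have "simplex_to_sphere d u i = 2 * ?t * (u i - 1 / real (Suc d)) / D"
    using i by (simp add: simplex_to_sphere_def D_def Let_def)
  ultimately show ?thesis
    using D t by (simp add: power2_eq_square)
qed

text \<open>
  By \<open>simplex_to_sphere_scaled\<close> the offsets of \<open>u\<close> and \<open>v\<close> are the multiples of one vector \<open>m\<close> by the
  two depths, also in coordinate 0 because the offsets sum to 0. Each ray from the barycentre contains
  only one point of this kind, since the depth does not increase along the ray while the factor does.
\<close>

lemma simplex_to_sphere_inj:
  assumes u: "u \<in> standard_simplex d" "simplex_depth d u > 0"
    and v: "v \<in> standard_simplex d" "simplex_depth d v > 0"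
    and eq: "simplex_to_sphere d u = simplex_to_sphere d v" and "i \<le> d"
  shows "u i = v i"
proof -
  let ?b = "1 / real (Suc d)"
  define p where "p i = simplex_to_sphere d v i / (1 - simplex_to_sphere d v 0)" for i
  define m where "m i = (if i = 0 then - (\<Sum>j = 1..d. p j) else p i)" for i
  have off: "w i - ?b = simplex_depth d w * m i"
    if w: "w \<in> standard_simplex d" "\<And>i. i \<in> {1..d} \<Longrightarrow> w i - ?b = simplex_depth d w * p i" and "i \<le> d"
    for w i
  proof (cases "i = 0")
    case True
    have "(\<Sum>j = 1..d. w j - ?b) = simplex_depth d w * (\<Sum>j = 1..d. p j)"
      using w(2) by (simp add: sum_distrib_left)
    moreover have "(\<Sum>j = 1..d. w j - ?b) = (1 - w 0) - real d * ?b"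
      using w(1) by (simp add: standard_simplex_def sum_split_0 sum_subtractf)
    ultimately show ?thesis
      using True by (simp add: m_def field_simps)
  next
    case False
    then show ?thesis using w(2)[of i] that by (simp add: m_def)
  qed
  have uo: "u i - ?b = simplex_depth d u * m i" if "i \<le> d" for i
    using off[OF u(1) _ that] simplex_to_sphere_scaled[OF u] eq by (simp add: p_def)
  have vo: "v i - ?b = simplex_depth d v * m i" if "i \<le> d" for i
    using off[OF v(1) _ that] simplex_to_sphere_scaled[OF v] by (simp add: p_def)
  have le: "simplex_depth d w \<le> simplex_depth d w'"
    if "simplex_depth d w > 0" "simplex_depth d w' > 0"
      "\<And>i. i \<le> d \<Longrightarrow> w i - ?b = simplex_depth d w * m i"
      "\<And>i. i \<le> d \<Longrightarrow> w' i - ?b = simplex_depth d w' * m i" for w w'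
  proof -
    let ?t = "simplex_depth d w" and ?t' = "simplex_depth d w'"
    obtain j where j: "j \<le> d" "?t' = real (Suc d) * w' j"
      using simplex_depth_attained by blast
    have "?t \<le> real (Suc d) * w j" using j(1) by (rule simplex_depth_le)
    also have "w j = ?b + ?t * m j" using that(3)[OF j(1)] by simp
    also have "real (Suc d) * (?b + ?t * m j) = 1 + real (Suc d) * (?t * m j)"
      by (simp only: distrib_left) simp
    finally have 1: "?t \<le> 1 + real (Suc d) * (?t * m j)" .
    have "?t' = real (Suc d) * (?b + ?t' * m j)" using j(2) that(4)[OF j(1)] by simp
    then have 2: "?t' = 1 + real (Suc d) * (?t' * m j)"
      by (simp only: distrib_left) simp
    \<comment> \<open>The coordinate \<open>j\<close> is smallest for \<open>w'\<close>, so \<open>?t' * (1 - a) = 1\<close> is an equality, while for \<open>w\<close> only an inequality holds.\<close>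
    define a where "a = real (Suc d) * m j"
    have "?t * (1 - a) \<le> 1" "?t' * (1 - a) = 1"
      using 1 2 by (simp_all add: a_def algebra_simps)
    then have "?t * (1 - a) \<le> ?t' * (1 - a)" "1 - a > 0"
      using that(2) by (simp, metis zero_less_mult_pos zero_less_one)
    then show ?thesis by simp
  qed
  have "simplex_depth d u = simplex_depth d v"
    using le[OF u(2) v(2) uo vo] le[OF v(2) u(2) vo uo] by simp
  then show ?thesis using uo[OF \<open>i \<le> d\<close>] vo[OF \<open>i \<le> d\<close>] by simp
qed

text \<open>
  Let \<open>p\<close> be the stereographic projection of \<open>y\<close>, completed to a vector \<open>m\<close> with coordinate sum 0, and
  let \<open>\<mu>\<close> be its smallest coordinate. The point of the simplex with offset \<open>t * m\<close> has depth
  \<open>1 + (d + 1) * t * \<mu>\<close>, and this has to be equal to \<open>t\<close>.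
\<close>

lemma simplex_to_sphere_surj:
  assumes y: "y \<in> topspace (nsphere d)" "y \<noteq> sphere_base"
  obtains u where "u \<in> standard_simplex d" "simplex_depth d u > 0" "simplex_to_sphere d u = y"
proof -
  let ?b = "1 / real (Suc d)" and ?N = "real (Suc d)"
  have y1: "(y 0)\<^sup>2 + (\<Sum>i = 1..d. (y i)\<^sup>2) = 1" and y2: "\<And>i. i > d \<Longrightarrow> y i = 0"
    using y(1) by (auto simp: nsphere sum_split_0)
  have "(y 0)\<^sup>2 \<le> 1"
    using y1 sum_nonneg[of "{1..d}" "\<lambda>i. (y i)\<^sup>2"] by simp
  then have "y 0 \<le> 1"
    by (simp add: abs_square_le_1 abs_le_iff)
  moreover have "y 0 \<noteq> 1"
  proof
    assume 0: "y 0 = 1"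
    then have "(\<Sum>i = 1..d. (y i)\<^sup>2) = 0" using y1 by simp
    then have "y i = 0" if "i \<in> {1..d}" for i
      using that by (simp add: sum_nonneg_eq_0_iff)
    then have "y i = sphere_base i" for i
      using 0 y2[of i] by (cases "i = 0"; cases "i \<le> d") (auto simp: sphere_base_def)
    then show False using y(2) by auto
  qed
  ultimately have y0: "1 - y 0 > 0" by simp
  define p where "p i = y i / (1 - y 0)" for i
  define m where "m i = (if i = 0 then - (\<Sum>j = 1..d. p j) else p i)" for i
  define \<mu> where "\<mu> = Min (m ` {..d})"
  have \<mu>_le: "\<mu> \<le> m i" if "i \<le> d" for i using that by (simp add: \<mu>_def)
  have sum_m: "(\<Sum>i\<le>d. m i) = 0" by (simp add: sum_split_0 m_def)
  have "?N * \<mu> \<le> (\<Sum>i\<le>d. m i)"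
    using sum_bounded_below[of "{..d}" \<mu> m] \<mu>_le by simp
  then have \<mu>0: "?N * \<mu> \<le> 0" using sum_m by simp
  define t where "t = 1 / (1 - ?N * \<mu>)"
  have t: "t > 0" and t_eq: "1 + ?N * (t * \<mu>) = t"
    using \<mu>0 by (auto simp: t_def field_simps)
  define u where "u i = ?b + t * m i" for i
  have Min_u: "Min (u ` {..d}) = ?b + t * \<mu>"
  proof (rule Min_eqI)
    have "\<mu> \<in> m ` {..d}" unfolding \<mu>_def by (intro Min_in) auto
    then show "?b + t * \<mu> \<in> u ` {..d}" by (auto simp: u_def)
    fix x assume "x \<in> u ` {..d}"
    then show "?b + t * \<mu> \<le> x" using \<mu>_le t by (auto simp: u_def)
  qed auto
  have depth: "simplex_depth d u = t"
    using t_eq by (simp add: simplex_depth_def Min_u distrib_left)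
  have u: "u \<in> standard_simplex d"
    unfolding standard_simplex_def mem_Collect_eq
  proof (intro conjI allI impI)
    fix i assume "i \<le> d"
    then have "t \<le> ?N * u i" using simplex_depth_le[of i d u] depth by simp
    then have "0 < ?N * u i" using t by linarith
    then show "0 \<le> u i" by (simp add: zero_less_mult_iff)
  next
    have "(\<Sum>i\<le>d. u i) = (\<Sum>i\<le>d. ?b) + t * (\<Sum>i\<le>d. m i)"
      unfolding u_def sum.distrib sum_distrib_left ..
    then show "(\<Sum>i\<le>d. u i) = 1" using sum_m by simp
  qed
  have "offset_square d u = t\<^sup>2 * (\<Sum>i = 1..d. (p i)\<^sup>2)"
    unfolding offset_square_def sum_distrib_left
    by (intro sum.cong) (auto simp: u_def m_def power_mult_distrib)
  also have "(\<Sum>i = 1..d. (p i)\<^sup>2) = (1 - (y 0)\<^sup>2) / (1 - y 0)\<^sup>2"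
    using y1 by (simp add: p_def power_divide flip: sum_divide_distrib)
  also have "1 - (y 0)\<^sup>2 = (1 - y 0) * (1 + y 0)"
    by (simp add: power2_eq_square algebra_simps)
  also have "(1 - y 0) * (1 + y 0) / (1 - y 0)\<^sup>2 = (1 + y 0) / (1 - y 0)"
    using y0 by (simp add: power2_eq_square)
  finally have S: "offset_square d u = t\<^sup>2 * ((1 + y 0) / (1 - y 0))" .
  have D: "offset_square d u + t\<^sup>2 = 2 * t\<^sup>2 / (1 - y 0)"
    using y0 by (simp add: S field_simps)
  have "simplex_to_sphere d u i = y i" for i
  proof -
    consider "i = 0" | "i \<in> {1..d}" | "i > d" by fastforce
    then show ?thesis
    proof cases
      case 1
      have "offset_square d u - t\<^sup>2 = 2 * t\<^sup>2 / (1 - y 0) * y 0"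
        using y0 by (simp add: S field_simps)
      then show ?thesis
        using 1 t y0 by (simp add: simplex_to_sphere_def depth D)
    next
      case 2
      then have "simplex_to_sphere d u i = 2 * t * (t * p i) / (2 * t\<^sup>2 / (1 - y 0))"
        by (simp add: simplex_to_sphere_def depth D u_def m_def Let_def)
      moreover have "2 * t * (t * (a / c)) / (2 * t\<^sup>2 / c) = a" if "c > 0" for a c
        using that t by (simp add: power2_eq_square)
      ultimately show ?thesis
        using y0 unfolding p_def by metis
    next
      case 3
      then show ?thesis using y2 by (simp add: simplex_to_sphere_def)
    qed
  qed
  then show thesis using that[OF u] depth t by auto
qed

section \<open>Attaching cells to a contractible subcomplex\<close>

lemma barycentric_coordinates:
  fixes \<sigma> :: "'v::finite set"
  assumes e: "bij_betw e {..d} \<sigma>" and x: "x \<in> simplex_on \<sigma>"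
  shows "(\<lambda>i. x $ e i) \<in> standard_simplex d"
proof -
  have "(\<Sum>i\<le>d. x $ e i) = (\<Sum>v\<in>\<sigma>. x $ v)"
    using e by (rule sum.reindex_bij_betw)
  also have "\<dots> = (\<Sum>v\<in>UNIV. x $ v)"
    by (rule sum.mono_neutral_left) (use x in \<open>auto simp: simplex_on_def support_def\<close>)
  finally show ?thesis
    using x by (auto simp: standard_simplex_def simplex_on_def)
qed

lemma continuous_map_simplex_to_sphere:
  fixes \<sigma> :: "'v::finite set"
  assumes e: "bij_betw e {..d} \<sigma>"
  shows "continuous_map (top_of_set (simplex_on \<sigma>)) (nsphere d)
      (\<lambda>x. simplex_to_sphere d (\<lambda>i. x $ e i))"
proof -
  note simp = barycentric_coordinates[OF e]
  have depth: "continuous_on (simplex_on \<sigma>) (\<lambda>x. simplex_depth d (\<lambda>i. x $ e i))"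
    unfolding simplex_depth_def by (intro continuous_intros continuous_on_Min) auto
  have offset: "continuous_on (simplex_on \<sigma>) (\<lambda>x. offset_square d (\<lambda>i. x $ e i))"
    unfolding offset_square_def by (intro continuous_intros)
  have "continuous_on (simplex_on \<sigma>) (\<lambda>x. simplex_to_sphere d (\<lambda>i. x $ e i) k)" for k
  proof -
    have ne: "offset_square d (\<lambda>i. x $ e i) + (simplex_depth d (\<lambda>i. x $ e i))\<^sup>2 \<noteq> 0"
      if "x \<in> simplex_on \<sigma>" for x
      using denominator_pos[OF simp[OF that]] by simp
    show ?thesis
      unfolding simplex_to_sphere_def Let_def
      by (cases "k = 0"; cases "k \<le> d") (auto intro!: continuous_intros depth offset ne)
  qed
  then have "continuous_map (top_of_set (simplex_on \<sigma>)) (powertop_real UNIV)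
      (\<lambda>x. simplex_to_sphere d (\<lambda>i. x $ e i))"
    by (simp add: continuous_map_componentwise_UNIV)
  moreover have "simplex_to_sphere d (\<lambda>i. x $ e i) \<in> topspace (nsphere d)" if "x \<in> simplex_on \<sigma>" for x
    using simplex_to_sphere_in[OF simp[OF that]] .
  ultimately show "continuous_map (top_of_set (simplex_on \<sigma>)) (nsphere d)
      (\<lambda>x. simplex_to_sphere d (\<lambda>i. x $ e i))"
    by (auto simp: nsphere continuous_map_in_subtopology)
qed

text \<open>
  Simplices outside \<open>L\<close> have the same cardinality, so all their proper faces lie in \<open>L\<close>. Sending each
  of them to its own sphere by \<open>simplex_to_sphere\<close>, and \<open>L\<close> to the base point, is therefore well defined
  and continuous, and identifies the points of \<open>L\<close> and nothing else.
\<close>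

theorem homotopy_equivalent_wedge_of_spheres:
  fixes K L :: "'v::finite set set"
  assumes asc: "abstract_simplicial_complex K" "abstract_simplicial_complex L"
    and L: "L \<subseteq> K" "L \<noteq> {}" "contractible (geometric_realisation L)"
    and card: "\<And>\<sigma>. \<sigma> \<in> K - L \<Longrightarrow> card \<sigma> = Suc d"
  shows "top_of_set (geometric_realisation K) homotopy_equivalent_space wedge_of_spheres (card (K - L)) d"
proof -
  let ?K = "geometric_realisation K" and ?L = "geometric_realisation L"
  let ?W = "wedge_of_spheres (card (K - L)) d"
  have W: "?W = wedge (\<lambda>_. nsphere d) (\<lambda>_. sphere_base) {..<card (K - L)}"
    unfolding wedge_of_spheres_def sphere_base_def[abs_def] ..
  obtain idx where idx: "bij_betw idx (K - L) {..<card (K - L)}"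
    using ex_bij_betw_finite_nat[of "K - L"] by (auto simp: atLeast0LessThan)
  have "\<exists>e. bij_betw e {..d} \<sigma>" if "\<sigma> \<in> K - L" for \<sigma>
    using ex_bij_betw_nat_finite[of \<sigma>] card[OF that] by (auto simp: atLeast0LessThan lessThan_Suc_atMost)
  then obtain e where e: "\<And>\<sigma>. \<sigma> \<in> K - L \<Longrightarrow> bij_betw (e \<sigma>) {..d} \<sigma>"
    by metis
  define cell where "cell \<sigma> x = simplex_to_sphere d (\<lambda>i. x $ e \<sigma> i)" for \<sigma> and x :: "real^'v"
  define q where "q x = (if support x \<in> K - L then
      wedge_inclusion (\<lambda>_. sphere_base) (idx (support x)) (cell (support x) x) else None)" for x
  have cell_sphere: "cell \<sigma> x \<in> topspace (nsphere d)" if "\<sigma> \<in> K - L" "x \<in> simplex_on \<sigma>" for \<sigma> x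
    unfolding cell_def
    using simplex_to_sphere_in[OF barycentric_coordinates[OF e]] that by auto
  have depth0: "simplex_depth d (\<lambda>i. x $ e \<sigma> i) = 0 \<longleftrightarrow> support x \<noteq> \<sigma>"
    if "\<sigma> \<in> K - L" "x \<in> simplex_on \<sigma>" for \<sigma> x
  proof -
    have "simplex_depth d (\<lambda>i. x $ e \<sigma> i) = 0 \<longleftrightarrow> (\<exists>i\<le>d. x $ e \<sigma> i = 0)"
      using simplex_depth_0_iff[OF barycentric_coordinates[OF e]] that by auto
    also have "\<dots> \<longleftrightarrow> (\<exists>v\<in>\<sigma>. x $ v = 0)"
      using e[OF that(1)] by (force simp: bij_betw_def)
    also have "\<dots> \<longleftrightarrow> support x \<noteq> \<sigma>"
      using that(2) by (auto simp: support_def simplex_on_def)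
    finally show ?thesis .
  qed
  have cell_base: "cell \<sigma> x = sphere_base \<longleftrightarrow> support x \<noteq> \<sigma>"
    if "\<sigma> \<in> K - L" "x \<in> simplex_on \<sigma>" for \<sigma> x
    unfolding cell_def
    using simplex_to_sphere_base[OF barycentric_coordinates[OF e]] depth0 that by auto
  have in_simplex: "x \<in> simplex_on (support x)" if "x \<in> ?K" for x
    using that by (auto simp: in_geometric_realisation_iff[OF asc(1)] simplex_on_def)
  have face_L: "support x \<in> L" if "\<sigma> \<in> K - L" "x \<in> simplex_on \<sigma>" "support x \<noteq> \<sigma>" for \<sigma> x
  proof -
    have "support x \<subseteq> \<sigma>" "support x \<noteq> {}"
      using that(2) support_nonempty[of x] by (auto simp: simplex_on_def)
    then have "support x \<in> K" "card (support x) \<noteq> card \<sigma>"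
      using simplicial_complex_face[OF asc(1)] that card_subset_eq[of \<sigma> "support x"] by auto
    then show ?thesis using card that(1) by (metis DiffI)
  qed
  have q_cell: "q x = wedge_inclusion (\<lambda>_. sphere_base) (idx \<sigma>) (cell \<sigma> x)"
    if "\<sigma> \<in> K - L" "x \<in> simplex_on \<sigma>" for \<sigma> x
    using that face_L[OF that] cell_base[OF that]
    by (cases "support x = \<sigma>") (auto simp: q_def wedge_inclusion_def)
  have q_L: "q x = None \<longleftrightarrow> x \<in> ?L" if "x \<in> ?K" for x
    using that cell_base[OF _ in_simplex[OF that]]
    by (auto simp: q_def wedge_inclusion_def in_geometric_realisation_iff[OF asc(1)]
        in_geometric_realisation_iff[OF asc(2)])
  have LK: "?L \<subseteq> ?K" using L(1) by (auto simp: geometric_realisation_def)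
  have simplex_K: "simplex_on \<sigma> \<subseteq> ?K" if "\<sigma> \<in> K" for \<sigma>
    using that by (auto simp: geometric_realisation_simplices)
  show ?thesis
  proof (rule quotient_by_contractible)
    show "?L \<noteq> {}"
    proof -
      obtain \<sigma> where \<sigma>: "\<sigma> \<in> L" "\<sigma> \<noteq> {}"
        using L(2) asc(2) by (auto simp: abstract_simplicial_complex_def)
      then show ?thesis
        by (auto simp: geometric_realisation_def)
    qed
    show "Hausdorff_space ?W"
      unfolding W
    proof (rule Hausdorff_space_wedge)
      show "Hausdorff_space (nsphere d)"
        unfolding nsphere by (intro Hausdorff_space_subtopology) (simp add: Hausdorff_space_product_topology)
      show "sphere_base \<in> topspace (nsphere d)"
        unfolding sphere_base_def[abs_def] by (rule in_topspace_nsphere)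
    qed
    show "continuous_map (top_of_set ?K) ?W q"
    proof (rule pasting_lemma_closed[where I = "insert None (Some ` (K - L))"
          and T = "\<lambda>i. case i of None \<Rightarrow> ?L | Some \<sigma> \<Rightarrow> simplex_on \<sigma>" and f = "\<lambda>_. q"])
      fix i assume i: "i \<in> insert None (Some ` (K - L))"
      let ?T = "case i of None \<Rightarrow> ?L | Some \<sigma> \<Rightarrow> simplex_on \<sigma>"
      show "closedin (top_of_set ?K) ?T"
        using i LK simplex_K[THEN subsetD]
        by (auto intro!: closed_subset compact_imp_closed compact_geometric_realisation compact_simplex_on)
      show "continuous_map (subtopology (top_of_set ?K) ?T) ?W q"
      proof (cases i)
        case None
        have "continuous_map (top_of_set ?L) ?W (\<lambda>_. None)"
          by (simp add: W wedge_points_def)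
        then have "continuous_map (top_of_set ?L) ?W q"
          by (rule continuous_map_eq) (use q_L subsetD[OF LK] in force)
        then show ?thesis using None LK by (simp add: subtopology_subtopology Int_absorb1)
      next
        case (Some \<sigma>)
        then have \<sigma>: "\<sigma> \<in> K - L" using i by auto
        have "continuous_map (nsphere d) ?W (wedge_inclusion (\<lambda>_. sphere_base) (idx \<sigma>))"
          unfolding W
          by (rule continuous_map_wedge_inclusion) (use idx \<sigma> in \<open>auto simp: bij_betw_def\<close>)
        then have "continuous_map (top_of_set (simplex_on \<sigma>)) ?W
            (wedge_inclusion (\<lambda>_. sphere_base) (idx \<sigma>) \<circ> cell \<sigma>)"
          using continuous_map_simplex_to_sphere[OF e[OF \<sigma>]] continuous_map_compose
          unfolding cell_def[abs_def] by blast
        then have "continuous_map (top_of_set (simplex_on \<sigma>)) ?W q"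
          by (rule continuous_map_eq) (use q_cell[OF \<sigma>] in auto)
        then show ?thesis using Some \<sigma> simplex_K[of \<sigma>] by (simp add: subtopology_subtopology Int_absorb1)
      qed
    next
      fix x assume "x \<in> topspace (top_of_set ?K)"
      then have x: "x \<in> ?K" by simp
      show "\<exists>j. j \<in> insert None (Some ` (K - L)) \<and>
          x \<in> (case j of None \<Rightarrow> ?L | Some \<sigma> \<Rightarrow> simplex_on \<sigma>) \<and> q x = q x"
      proof (cases "support x \<in> L")
        case True
        then have "x \<in> ?L"
          using x by (simp add: in_geometric_realisation_iff[OF asc(1)] in_geometric_realisation_iff[OF asc(2)])
        then show ?thesis by (intro exI[of _ None]) auto
      next
        case False
        then have "support x \<in> K - L"
          using x by (simp add: in_geometric_realisation_iff[OF asc(1)])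
        then show ?thesis using in_simplex[OF x] by (intro exI[of _ "Some (support x)"]) auto
      qed
    qed auto
    show "q ` ?K = topspace ?W"
    proof
      show "q ` ?K \<subseteq> topspace ?W"
        using continuous_map_image_subset_topspace[OF \<open>continuous_map (top_of_set ?K) ?W q\<close>] by simp
      show "topspace ?W \<subseteq> q ` ?K"
      proof
        fix z assume z: "z \<in> topspace ?W"
        show "z \<in> q ` ?K"
        proof (cases z)
          case None
          obtain x where "x \<in> ?L" using \<open>?L \<noteq> {}\<close> by blast
          then show ?thesis using None q_L LK by force
        next
          case (Some iy)
          then obtain i y where y: "z = Some (i, y)" "i < card (K - L)" "y \<in> topspace (nsphere d)" "y \<noteq> sphere_base"
            using z by (auto simp: W wedge_points_def wedge_inclusion_def split: if_splits)
          then obtain \<sigma> where \<sigma>: "\<sigma> \<in> K - L" "i = idx \<sigma>"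
            using bij_betw_imp_surj_on[OF idx] by (metis imageE lessThan_iff)
          obtain u where u: "u \<in> standard_simplex d" "simplex_to_sphere d u = y"
            using simplex_to_sphere_surj[OF y(3,4)] by metis
          let ?e' = "inv_into {..d} (e \<sigma>)"
          define x :: "real^'v" where "x = (\<chi> v. if v \<in> \<sigma> then u (?e' v) else 0)"
          have e': "bij_betw ?e' \<sigma> {..d}" using e[OF \<sigma>(1)] by (rule bij_betw_inv_into)
          have xe: "x $ e \<sigma> i = u i" if "i \<le> d" for i
            using that e[OF \<sigma>(1)] by (auto simp: x_def bij_betw_def)
          have "(\<Sum>v\<in>UNIV. x $ v) = (\<Sum>v\<in>\<sigma>. u (?e' v))"
            by (simp add: x_def sum.If_cases)
          also have "\<dots> = (\<Sum>i\<le>d. u i)"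
            using e' by (rule sum.reindex_bij_betw)
          finally have x: "x \<in> simplex_on \<sigma>"
            using u(1) bij_betwE[OF e'] by (auto simp: simplex_on_def standard_simplex_def x_def support_def)
          have "simplex_depth d (\<lambda>i. x $ e \<sigma> i) = simplex_depth d u"
            unfolding simplex_depth_def using xe by (intro arg_cong2[where f = "(*)"] arg_cong[where f = Min] image_cong) auto
          moreover have "offset_square d (\<lambda>i. x $ e \<sigma> i) = offset_square d u"
            unfolding offset_square_def using xe by (intro sum.cong) auto
          ultimately have "cell \<sigma> x = simplex_to_sphere d u"
            unfolding cell_def by (auto simp: simplex_to_sphere_def fun_eq_iff xe Let_def)
          then have "q x = z"
            using q_cell[OF \<sigma>(1) x] y \<sigma> u by (simp add: wedge_inclusion_def)
          then show ?thesis using x simplex_K \<sigma>(1) by auto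
        qed
      qed
    qed
    show "q x = q y \<longleftrightarrow> x = y \<or> x \<in> ?L \<and> y \<in> ?L" if xy: "x \<in> ?K" "y \<in> ?K" for x y
    proof (cases "x \<in> ?L \<or> y \<in> ?L")
      case True
      then show ?thesis using q_L xy by metis
    next
      case False
      have *: "support z \<in> K - L" "cell (support z) z \<noteq> sphere_base" if "z \<in> ?K" "z \<notin> ?L" for z
      proof -
        show "support z \<in> K - L"
          using that by (auto simp: in_geometric_realisation_iff[OF asc(1)] in_geometric_realisation_iff[OF asc(2)])
        then show "cell (support z) z \<noteq> sphere_base"
          using cell_base in_simplex[OF that(1)] by blast
      qed
      have "x = y" if qq: "q x = q y"
      proof -
        have "idx (support x) = idx (support y)" and cc: "cell (support x) x = cell (support y) y"
          using qq *[of x] *[of y] False xy by (auto simp: q_def wedge_inclusion_def)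
        then have s: "support y = support x"
          using idx *(1)[of x] *(1)[of y] False xy by (metis bij_betw_def inj_onD)
        let ?\<sigma> = "support x"
        have \<sigma>: "?\<sigma> \<in> K - L" "x \<in> simplex_on ?\<sigma>" "y \<in> simplex_on ?\<sigma>"
          using *(1)[of x] False xy in_simplex s by metis+
        have u: "(\<lambda>i. x $ e ?\<sigma> i) \<in> standard_simplex d" "(\<lambda>i. y $ e ?\<sigma> i) \<in> standard_simplex d"
          using barycentric_coordinates[OF e[OF \<sigma>(1)]] \<sigma> by auto
        have pos: "simplex_depth d (\<lambda>i. x $ e ?\<sigma> i) > 0" "simplex_depth d (\<lambda>i. y $ e ?\<sigma> i) > 0"
          using depth0[OF \<sigma>(1,2)] depth0[OF \<sigma>(1,3)] s simplex_depth_nonneg[OF u(1)] simplex_depth_nonneg[OF u(2)]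
          by (simp_all add: less_le)
        have "x $ e ?\<sigma> i = y $ e ?\<sigma> i" if "i \<le> d" for i
          using simplex_to_sphere_inj[OF u(1) pos(1) u(2) pos(2) _ that] cc s by (simp add: cell_def)
        then have "x $ v = y $ v" if "v \<in> ?\<sigma>" for v
          using e[OF \<sigma>(1)] that by (force simp: bij_betw_def)
        moreover have "x $ v = y $ v" if "v \<notin> ?\<sigma>" for v
          using that s by (auto simp: support_def)
        ultimately show "x = y" by (metis vec_eq_iff)
      qed
      then show ?thesis using False by auto
    qed
  qed (use L LK in \<open>auto intro: ANR_geometric_realisation compact_geometric_realisation
      compact_imp_closed\<close>)
qed

section \<open>Independence complexes of matroids\<close>

lemma finite_has_maximiser:
  fixes f :: "'a \<Rightarrow> nat"
  assumes "finite S" "S \<noteq> {}"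
  obtains x where "x \<in> S" "\<And>y. y \<in> S \<Longrightarrow> f y \<le> f x"
proof -
  have "Max (f ` S) \<in> f ` S" using assms by (intro Max_in) auto
  then obtain x where "x \<in> S" "f x = Max (f ` S)" by force
  then show thesis using assms(1) by (intro that[of x]) auto
qed

text \<open>
  Matroids on a finite type are given by their independent sets. Elements that belong to no
  independent set (loops) are allowed; the zero vector will be one, and so will sets of vectors that
  are not lines.
\<close>

locale matroid_of_rank =
  fixes indep :: "'v::finite set \<Rightarrow> bool" and r :: nat
  assumes indep_subset: "indep \<sigma> \<Longrightarrow> \<tau> \<subseteq> \<sigma> \<Longrightarrow> indep \<tau>"
    and augment: "indep \<sigma> \<Longrightarrow> indep \<tau> \<Longrightarrow> card \<sigma> < card \<tau> \<Longrightarrow> \<exists>v\<in>\<tau> - \<sigma>. indep (insert v \<sigma>)"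
    and card_le_rank: "indep \<sigma> \<Longrightarrow> card \<sigma> \<le> r"
    and base_exists: "\<exists>\<sigma>. indep \<sigma> \<and> card \<sigma> = r"
    and rank_pos: "r > 0"
begin

definition base :: "'v set \<Rightarrow> bool" where
  "base B \<longleftrightarrow> indep B \<and> card B = r"

lemma base_subset_eq: "base B \<Longrightarrow> base B' \<Longrightarrow> B \<subseteq> B' \<Longrightarrow> B = B'"
  by (simp add: base_def card_subset_eq)

lemma extend_to_base:
  assumes "indep \<sigma>" "base B"
  shows "\<exists>B'. base B' \<and> \<sigma> \<subseteq> B' \<and> B' \<subseteq> \<sigma> \<union> B"
  using assms(1)
proof (induction "r - card \<sigma>" arbitrary: \<sigma>)
  case 0
  then have "base \<sigma>" using card_le_rank[of \<sigma>] by (simp add: base_def)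
  then show ?case by blast
next
  case (Suc k)
  then have "card \<sigma> < card B" using assms(2) by (simp add: base_def)
  then obtain v where v: "v \<in> B - \<sigma>" "indep (insert v \<sigma>)"
    using augment Suc.prems assms(2) by (metis base_def)
  then have "k = r - card (insert v \<sigma>)" using Suc.hyps(2) by simp
  from Suc.hyps(1)[OF this v(2)] show ?case using v(1) by blast
qed

text \<open>
  Extending \<open>B \<inter> B'\<close> together with \<open>w\<close> to a base by elements of \<open>B\<close> leaves out exactly one element
  of \<open>B\<close>, and that one is not in \<open>B'\<close>.
\<close>

lemma base_exchange:
  assumes "base B" "base B'" "w \<in> B' - B"
  shows "\<exists>v\<in>B - B'. base (insert w (B - {v}))"
proof -
  have "indep (insert w (B \<inter> B'))"
    using indep_subset[of B'] assms by (auto simp: base_def)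
  then obtain C where C: "base C" "insert w (B \<inter> B') \<subseteq> C" "C \<subseteq> insert w (B \<inter> B') \<union> B"
    using extend_to_base assms(1) by blast
  have "\<not> B \<subseteq> C"
    using base_subset_eq[OF assms(1) C(1)] C(2) assms(3) by blast
  then obtain v where v: "v \<in> B" "v \<notin> C" by blast
  have "card (insert w (B - {v})) = r"
    using assms v card_Suc_Diff1[of B v] by (simp add: base_def)
  moreover have "C \<subseteq> insert w (B - {v})" using C v by blast
  ultimately have "C = insert w (B - {v})"
    using C(1) by (intro card_subset_eq) (auto simp: base_def)
  then show ?thesis using C v by blast
qed

text \<open>
  Comparing weights is comparing sets by the largest element of their symmetric difference, for the
  linear order of the ground set given by \<open>to_nat\<close>.
\<close>

definition weight :: "'v set \<Rightarrow> nat" where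
  "weight \<sigma> = (\<Sum>v\<in>\<sigma>. 2 ^ to_nat v)"

text \<open>
  The elements of \<open>\<sigma> - \<tau>\<close> contribute less than \<open>2 ^ to_nat w\<close>, by the geometric series.
\<close>

lemma weight_less:
  assumes w: "w \<in> \<tau> - \<sigma>" and less: "\<And>v. v \<in> \<sigma> - \<tau> \<Longrightarrow> to_nat v < to_nat w"
  shows "weight \<sigma> < weight \<tau>"
proof -
  have split: "weight \<rho> = weight (\<rho> \<inter> \<rho>') + weight (\<rho> - \<rho>')" for \<rho> \<rho>'
    unfolding weight_def by (subst sum.union_disjoint[symmetric]) (auto intro!: sum.cong)
  have "weight (\<sigma> - \<tau>) = (\<Sum>k\<in>to_nat ` (\<sigma> - \<tau>). 2 ^ k)"
    by (simp add: weight_def sum.reindex inj_on_def)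
  also have "\<dots> \<le> (\<Sum>k<to_nat w. 2 ^ k)"
    using less by (intro sum_mono2) auto
  also have "\<dots> < 2 ^ to_nat w"
    by (simp flip: mask_eq_sum_exp_nat add: lessThan_def)
  also have "\<dots> \<le> weight (\<tau> - \<sigma>)"
    using w member_le_sum[of w "\<tau> - \<sigma>" "\<lambda>v. (2::nat) ^ to_nat v"] by (simp add: weight_def)
  finally show ?thesis
    using split[of \<sigma> \<tau>] split[of \<tau> \<sigma>] by (simp add: Int_commute)
qed

lemma weight_le_obtains:
  assumes "weight \<sigma> \<le> weight \<tau>" "\<sigma> \<noteq> \<tau>"
  obtains w where "w \<in> \<tau> - \<sigma>" "\<And>v. v \<in> \<sigma> - \<tau> \<Longrightarrow> to_nat v < to_nat w"
proof -
  let ?D = "(\<sigma> - \<tau>) \<union> (\<tau> - \<sigma>)"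
  have "?D \<noteq> {}" using assms(2) by blast
  then obtain w where w: "w \<in> ?D" "\<And>v. v \<in> ?D \<Longrightarrow> to_nat v \<le> to_nat w"
    by (rule finite_has_maximiser[OF finite, where f = to_nat]) auto
  have lt: "to_nat v < to_nat w" if "v \<in> ?D" "v \<noteq> w" for v
    using w(2)[OF that(1)] that(2) by (metis inj_to_nat injD le_neq_implies_less)
  show thesis
  proof (cases "w \<in> \<tau>")
    case True
    then have "w \<in> \<tau> - \<sigma>" using w(1) by blast
    then show ?thesis using lt by (intro that[of w]) blast+
  next
    case False
    then have "w \<in> \<sigma> - \<tau>" using w(1) by blast
    then have "weight \<tau> < weight \<sigma>" using lt by (intro weight_less[of w]) blast+
    then show ?thesis using assms(1) by simp
  qed
qed

lemma weight_inj: "weight \<sigma> = weight \<tau> \<Longrightarrow> \<sigma> = \<tau>"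
  by (metis weight_le_obtains weight_less le_refl nless_le)

text \<open>
  The internally passive elements of a base, in the terminology of the Tutte polynomial. They form the
  restriction of the base in the lexicographic shelling.
\<close>

definition passive_part :: "'v set \<Rightarrow> 'v set" where
  "passive_part B = {v \<in> B. \<exists>w. w \<notin> B \<and> to_nat v < to_nat w \<and> base (insert w (B - {v}))}"

lemma passive_subset: "passive_part B \<subseteq> B"
  by (auto simp: passive_part_def)

text \<open>
  If \<open>B'\<close> were heavier, the largest element \<open>w\<close> of the symmetric difference would lie in \<open>B'\<close>, and the
  exchange of \<open>w\<close> for a suitable \<open>v \<in> B - B'\<close> would show that \<open>v\<close> is passive.
\<close>

lemma heaviest_if_passive:
  assumes "base B" "base B'" "passive_part B \<subseteq> B'"
  shows "weight B' \<le> weight B"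
proof (rule ccontr)
  assume "\<not> ?thesis"
  then obtain w where w: "w \<in> B' - B" "\<And>v. v \<in> B - B' \<Longrightarrow> to_nat v < to_nat w"
    using weight_le_obtains[of B B'] by (metis nle_le order_refl)
  obtain v where v: "v \<in> B - B'" "base (insert w (B - {v}))"
    using base_exchange[OF assms(1,2) w(1)] by blast
  then have "v \<in> passive_part B" using w by (auto simp: passive_part_def)
  then show False using assms(3) v by blast
qed

lemma heavier_if_not_passive:
  assumes "\<sigma> \<subseteq> B" "\<not> passive_part B \<subseteq> \<sigma>"
  shows "\<exists>B'. base B' \<and> \<sigma> \<subseteq> B' \<and> weight B < weight B'"
proof -
  obtain v w where v: "v \<in> B" "v \<notin> \<sigma>" "w \<notin> B" "to_nat v < to_nat w" "base (insert w (B - {v}))"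
    using assms(2) by (auto simp: passive_part_def)
  have "weight B < weight (insert w (B - {v}))"
    by (rule weight_less[of w]) (use v in auto)
  then show ?thesis using v assms(1) by blast
qed

text \<open>
  The heaviest base that contains \<open>\<sigma>\<close> has this property: a passive element outside \<open>\<sigma>\<close> could be
  exchanged for a larger one, and the heavier base would still contain \<open>\<sigma>\<close>.
\<close>

lemma interval_exists:
  assumes "indep \<sigma>"
  obtains B where "base B" "passive_part B \<subseteq> \<sigma>" "\<sigma> \<subseteq> B"
proof -
  let ?S = "{B. base B \<and> \<sigma> \<subseteq> B}"
  have "?S \<noteq> {}"
    using extend_to_base[OF assms] base_exists unfolding base_def by blast
  then obtain B where B: "base B" "\<sigma> \<subseteq> B" "\<And>B'. base B' \<Longrightarrow> \<sigma> \<subseteq> B' \<Longrightarrow> weight B' \<le> weight B"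
    by (rule finite_has_maximiser[rotated, where f = weight]) auto
  have "passive_part B \<subseteq> \<sigma>"
    using heavier_if_not_passive[OF B(2)] B(3) by (metis not_less)
  then show thesis using that B by blast
qed

lemma interval_unique:
  assumes "base B" "passive_part B \<subseteq> \<sigma>" "\<sigma> \<subseteq> B" "base B'" "passive_part B' \<subseteq> \<sigma>" "\<sigma> \<subseteq> B'"
  shows "B = B'"
  using assms heaviest_if_passive[of B B'] heaviest_if_passive[of B' B]
  by (intro weight_inj) (meson order_antisym subset_trans)

definition critical :: "'v set set" where
  "critical = {B. base B \<and> passive_part B = B}"

text \<open>
  The union of the intervals of noncritical bases of weight at least \<open>c\<close>. The critical bases
  can be left out of every stage: being facets, they are not faces of sets that are added later.
\<close>

definition shelling_stage :: "nat \<Rightarrow> 'v set set" where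
  "shelling_stage c = {\<sigma>. \<sigma> \<noteq> {} \<and>
     (\<exists>B. base B \<and> passive_part B \<noteq> B \<and> c \<le> weight B \<and> passive_part B \<subseteq> \<sigma> \<and> \<sigma> \<subseteq> B)}"

lemma abstract_simplicial_complex_indep:
  "abstract_simplicial_complex {\<sigma>. indep \<sigma> \<and> \<sigma> \<noteq> {}}"
  unfolding abstract_simplicial_complex_def using indep_subset by auto

text \<open>
  A face of a set in the interval of \<open>B\<close> lies in the interval of a base at least as heavy as \<open>B\<close>. If
  that base were critical, it would be equal to the face, hence to \<open>B\<close>.
\<close>

lemma abstract_simplicial_complex_stage: "abstract_simplicial_complex (shelling_stage c)"
  unfolding abstract_simplicial_complex_def
proof (intro ballI conjI allI impI)
  fix \<sigma> assume \<sigma>: "\<sigma> \<in> shelling_stage c"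
  then show "finite \<sigma>" "\<sigma> \<noteq> {}" by (auto simp: shelling_stage_def)
  fix \<tau> assume \<tau>: "\<tau> \<subseteq> \<sigma>" "\<tau> \<noteq> {}"
  obtain B where B: "base B" "passive_part B \<noteq> B" "c \<le> weight B" "\<sigma> \<subseteq> B"
    using \<sigma> by (auto simp: shelling_stage_def)
  have "indep \<tau>" using indep_subset[of B] B \<tau> by (auto simp: base_def)
  then obtain B' where B': "base B'" "passive_part B' \<subseteq> \<tau>" "\<tau> \<subseteq> B'"
    by (rule interval_exists)
  have "weight B \<le> weight B'"
    using heaviest_if_passive[OF B'(1) B(1)] B'(2) B(4) \<tau>(1) by blast
  moreover have "passive_part B' \<noteq> B'"
  proof
    assume eq: "passive_part B' = B'"
    then have "B' = B" using base_subset_eq[OF B'(1) B(1)] B' B(4) \<tau>(1) by blast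
    then show False using eq B(2) by simp
  qed
  ultimately show "\<tau> \<in> shelling_stage c"
    using B' B(3) \<tau>(2) unfolding shelling_stage_def by (blast intro: order_trans)
qed

lemma heaviest_base:
  obtains B where "base B" "passive_part B = {}" "\<And>B'. base B' \<Longrightarrow> passive_part B' = {} \<Longrightarrow> B' = B"
    "\<And>B'. base B' \<Longrightarrow> weight B' \<le> weight B"
proof -
  obtain \<sigma> where "indep \<sigma>" using base_exists by blast
  then have "indep {}" using indep_subset by blast
  then obtain B where B: "base B" "passive_part B \<subseteq> {}" "{} \<subseteq> B" by (rule interval_exists)
  show thesis
  proof (rule that[of B])
    show "B' = B" if "base B'" "passive_part B' = {}" for B'
      using interval_unique[of B' "{}" B] that B by simp
  qed (use B heaviest_if_passive[of B] in auto)
qed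

text \<open>
  Induction on decreasing weight. Weights are injective, so lowering the bound by one adds at most one
  interval, whose lower end is nonempty except for the heaviest base.
\<close>

lemma contractible_stage_0: "contractible (geometric_realisation (shelling_stage 0))"
proof -
  obtain B0 where B0: "base B0" "passive_part B0 = {}"
    and uniq: "\<And>B'. base B' \<Longrightarrow> passive_part B' = {} \<Longrightarrow> B' = B0"
    and heaviest: "\<And>B'. base B' \<Longrightarrow> weight B' \<le> weight B0"
    by (rule heaviest_base) (rule that)
  have B0_ne: "B0 \<noteq> {}" using B0(1) rank_pos by (auto simp: base_def)
  have "contractible (geometric_realisation (shelling_stage c))" if "c \<le> weight B0" for c
    using that
  proof (induction rule: inc_induct)
    case base
    have "B = B0" if "base B" "weight B0 \<le> weight B" for B
      using heaviest[OF that(1)] that(2) by (intro weight_inj) simp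
    then have eq: "shelling_stage (weight B0) = {\<sigma>. \<sigma> \<noteq> {} \<and> \<sigma> \<subseteq> B0}"
      using B0 B0_ne unfolding shelling_stage_def by blast
    have "geometric_realisation (shelling_stage (weight B0)) = simplex_on B0"
      unfolding eq geometric_realisation_simplices using B0_ne
      by (auto simp: simplex_on_def)
    then show ?case by (simp add: convex_imp_contractible convex_simplex_on)
  next
    case (step n)
    show ?case
    proof (cases "\<exists>B. base B \<and> passive_part B \<noteq> B \<and> weight B = n")
      case False
      then have "shelling_stage n = shelling_stage (Suc n)"
        unfolding shelling_stage_def by (metis Suc_le_eq Suc_leD le_neq_implies_less)
      then show ?thesis using step.IH by simp
    next
      case True
      then obtain B where B: "base B" "passive_part B \<noteq> B" "weight B = n" by blast
      have ne: "passive_part B \<noteq> {}" using uniq[OF B(1)] B(3) step.hyps by auto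
      have same: "B' = B" if "weight B' = n" for B' using that B(3) by (intro weight_inj) simp
      have split: "n \<le> weight B' \<longleftrightarrow> Suc n \<le> weight B' \<or> B' = B" for B'
        using same[of B'] B(3) by (metis Suc_leD Suc_leI le_neq_implies_less order_refl)
      have "shelling_stage n = shelling_stage (Suc n) \<union> {\<sigma>. passive_part B \<subseteq> \<sigma> \<and> \<sigma> \<subseteq> B}"
        unfolding shelling_stage_def split using B ne by blast
      moreover have "passive_part B \<notin> shelling_stage (Suc n)"
      proof
        assume "passive_part B \<in> shelling_stage (Suc n)"
        then obtain B' where "base B'" "Suc n \<le> weight B'" "passive_part B \<subseteq> B'"
          by (auto simp: shelling_stage_def)
        then show False using heaviest_if_passive[OF B(1), of B'] B(3) by simp
      qed
      moreover have "passive_part B \<subset> B" using passive_subset B(2) by blast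
      ultimately show ?thesis
        using contractible_interval_expansion[OF abstract_simplicial_complex_stage
            abstract_simplicial_complex_stage _ ne _ _ step.IH] by blast
    qed
  qed
  then show ?thesis by blast
qed

lemma indep_minus_stage_0: "{\<sigma>. indep \<sigma> \<and> \<sigma> \<noteq> {}} - shelling_stage 0 = critical"
proof (rule equalityI; rule subsetI)
  fix \<sigma> assume \<sigma>: "\<sigma> \<in> {\<sigma>. indep \<sigma> \<and> \<sigma> \<noteq> {}} - shelling_stage 0"
  then obtain B where B: "base B" "passive_part B \<subseteq> \<sigma>" "\<sigma> \<subseteq> B"
    using interval_exists[of \<sigma>] by blast
  then have "passive_part B = B" using \<sigma> by (auto simp: shelling_stage_def)
  then show "\<sigma> \<in> critical" using B by (auto simp: critical_def)
next
  fix \<sigma> assume \<sigma>: "\<sigma> \<in> critical"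
  then have "\<sigma> \<noteq> {}" "indep \<sigma>" using rank_pos by (auto simp: critical_def base_def)
  moreover have "\<sigma> \<notin> shelling_stage 0"
  proof
    assume "\<sigma> \<in> shelling_stage 0"
    then obtain B where B: "base B" "passive_part B \<noteq> B" "\<sigma> \<subseteq> B"
      by (auto simp: shelling_stage_def)
    then have "\<sigma> = B" using base_subset_eq[of \<sigma> B] \<sigma> by (auto simp: critical_def)
    then show False using B(2) \<sigma> by (simp add: critical_def)
  qed
  ultimately show "\<sigma> \<in> {\<sigma>. indep \<sigma> \<and> \<sigma> \<noteq> {}} - shelling_stage 0" by blast
qed

theorem independence_complex_wedge_of_spheres:
  "top_of_set (geometric_realisation {\<sigma>. indep \<sigma> \<and> \<sigma> \<noteq> {}})
     homotopy_equivalent_space wedge_of_spheres (card critical) (r - 1)"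
proof -
  let ?K = "{\<sigma>. indep \<sigma> \<and> \<sigma> \<noteq> {}}"
  obtain B0 where "base B0" "passive_part B0 = {}" by (rule heaviest_base)
  then have "B0 \<in> shelling_stage 0" using rank_pos by (auto simp: shelling_stage_def base_def)
  then have ne: "shelling_stage 0 \<noteq> {}" by blast
  have sub: "shelling_stage 0 \<subseteq> ?K"
    using indep_subset unfolding shelling_stage_def base_def by blast
  have "card \<sigma> = Suc (r - 1)" if "\<sigma> \<in> ?K - shelling_stage 0" for \<sigma>
    using that rank_pos unfolding indep_minus_stage_0 by (simp add: critical_def base_def)
  from homotopy_equivalent_wedge_of_spheres[OF abstract_simplicial_complex_indep
      abstract_simplicial_complex_stage sub ne contractible_stage_0 this]
  show ?thesis unfolding indep_minus_stage_0 .
qed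

text \<open>
  The binomial expansion of \<open>(1 - 1) ^ card (B - R)\<close>.
\<close>

lemma sum_alternating_interval:
  fixes R B :: "'v set"
  assumes "R \<subseteq> B"
  shows "(\<Sum>\<sigma> | R \<subseteq> \<sigma> \<and> \<sigma> \<subseteq> B. (-1 :: real) ^ card \<sigma>) = (if R = B then (-1) ^ card B else 0)"
proof -
  have "(\<Sum>\<sigma> | R \<subseteq> \<sigma> \<and> \<sigma> \<subseteq> B. (-1 :: real) ^ card \<sigma>) = (\<Sum>T\<in>Pow (B - R). (-1) ^ card (R \<union> T))"
    by (rule sum.reindex_bij_witness[of _ "\<lambda>T. R \<union> T" "\<lambda>\<sigma>. \<sigma> - R"])
       (use assms in \<open>auto simp: Un_absorb1 Un_Diff_cancel\<close>)
  also have "\<dots> = (\<Sum>T\<in>Pow (B - R). (-1) ^ card R * (-1) ^ card T)"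
    by (intro sum.cong refl, subst card_Un_disjoint) (auto simp: power_add)
  also have "\<dots> = (-1) ^ card R * (\<Sum>T\<in>Pow (B - R). (\<Prod>i\<in>T. -1) * (\<Prod>i\<in>B - R - T. 1))"
    by (simp add: sum_distrib_left)
  also have "(\<Sum>T\<in>Pow (B - R). (\<Prod>i\<in>T. -1) * (\<Prod>i\<in>B - R - T. 1)) = (\<Prod>i\<in>B - R. (-1) + (1 :: real))"
    by (rule prod_add[symmetric]) simp
  finally show ?thesis using assms by auto
qed

lemma card_critical:
  "real (card critical) = (\<Sum>k\<le>r. (-1) ^ (r - k) * real (card {\<sigma>. indep \<sigma> \<and> card \<sigma> = k}))"
proof -
  let ?I = "\<lambda>B. {\<sigma>. passive_part B \<subseteq> \<sigma> \<and> \<sigma> \<subseteq> B}"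
  have "{\<sigma>. indep \<sigma>} = (\<Union>B\<in>{B. base B}. ?I B)"
  proof (rule equalityI; rule subsetI)
    fix \<sigma> assume "\<sigma> \<in> {\<sigma>. indep \<sigma>}"
    then have "indep \<sigma>" by simp
    then obtain B where "base B" "passive_part B \<subseteq> \<sigma>" "\<sigma> \<subseteq> B" by (rule interval_exists)
    then show "\<sigma> \<in> (\<Union>B\<in>{B. base B}. ?I B)" by blast
  next
    fix \<sigma> assume "\<sigma> \<in> (\<Union>B\<in>{B. base B}. ?I B)"
    then show "\<sigma> \<in> {\<sigma>. indep \<sigma>}" using indep_subset unfolding base_def by blast
  qed
  then have "(\<Sum>\<sigma> | indep \<sigma>. (-1 :: real) ^ card \<sigma>) = (\<Sum>\<sigma>\<in>(\<Union>B\<in>{B. base B}. ?I B). (-1) ^ card \<sigma>)"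
    by simp
  also have "\<dots> = (\<Sum>B | base B. \<Sum>\<sigma>\<in>?I B. (-1) ^ card \<sigma>)"
  proof (rule sum.UNION_disjoint)
    show "\<forall>B\<in>{B. base B}. \<forall>B'\<in>{B. base B}. B \<noteq> B' \<longrightarrow> ?I B \<inter> ?I B' = {}"
      using interval_unique by blast
  qed simp_all
  also have "\<dots> = (\<Sum>B | base B. if passive_part B = B then (-1) ^ r else 0)"
    by (intro sum.cong refl) (simp add: sum_alternating_interval[OF passive_subset] base_def)
  also have "\<dots> = (-1) ^ r * real (card critical)"
    by (simp add: sum.If_cases critical_def Int_def)
  finally have 1: "(\<Sum>\<sigma> | indep \<sigma>. (-1 :: real) ^ card \<sigma>) = (-1) ^ r * real (card critical)" .
  have "(\<Sum>\<sigma> | indep \<sigma>. (-1 :: real) ^ card \<sigma>)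
      = (\<Sum>k\<le>r. \<Sum>\<sigma> | \<sigma> \<in> {\<sigma>. indep \<sigma>} \<and> card \<sigma> = k. (-1) ^ card \<sigma>)"
    by (rule sum.group[symmetric]) (use card_le_rank in auto)
  also have "\<dots> = (\<Sum>k\<le>r. (-1) ^ k * real (card {\<sigma>. indep \<sigma> \<and> card \<sigma> = k}))"
    by (intro sum.cong refl) simp
  finally have 2: "(\<Sum>\<sigma> | indep \<sigma>. (-1 :: real) ^ card \<sigma>)
      = (\<Sum>k\<le>r. (-1) ^ k * real (card {\<sigma>. indep \<sigma> \<and> card \<sigma> = k}))" .
  have "real (card critical) = (-1) ^ r * ((-1) ^ r * real (card critical))"
    by (simp add: minus_one_power_iff)
  also have "\<dots> = (-1) ^ r * (\<Sum>k\<le>r. (-1) ^ k * real (card {\<sigma>. indep \<sigma> \<and> card \<sigma> = k}))"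
    using 1 2 by simp
  also have "\<dots> = (\<Sum>k\<le>r. (-1) ^ (r - k) * real (card {\<sigma>. indep \<sigma> \<and> card \<sigma> = k}))"
    unfolding sum_distrib_left mult.assoc[symmetric]
    by (intro sum.cong refl arg_cong2[of _ _ _ _ "(*)"])
       (simp flip: power_add add: minus_one_power_iff)
  finally show ?thesis .
qed

text \<open>
  Double counting of pairs of an independent set of size \<open>k + 1\<close> and one of its elements:
  \<open>e k\<close> times the number of independent sets of size \<open>k\<close> is \<open>k + 1\<close> times the number of those
  of size \<open>k + 1\<close>.
\<close>

lemma card_indep_of_card:
  assumes ext: "\<And>\<sigma>. indep \<sigma> \<Longrightarrow> card {v. v \<notin> \<sigma> \<and> indep (insert v \<sigma>)} = e (card \<sigma>)"
  shows "real (card {\<sigma>. indep \<sigma> \<and> card \<sigma> = k}) = (\<Prod>j<k. real (e j)) / fact k"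
proof (induction k)
  case 0
  obtain \<sigma> where "indep \<sigma>" using base_exists by blast
  then have "indep {}" using indep_subset by blast
  then have "{\<sigma>. indep \<sigma> \<and> card \<sigma> = 0} = {{}}" by auto
  then show ?case by simp
next
  case (Suc k)
  let ?F = "\<lambda>k. {\<sigma>. indep \<sigma> \<and> card \<sigma> = k}"
  let ?ext = "\<lambda>\<sigma>. {v. v \<notin> \<sigma> \<and> indep (insert v \<sigma>)}"
  have "bij_betw (\<lambda>(\<sigma>, v). (insert v \<sigma>, v)) (Sigma (?F k) ?ext) (Sigma (?F (Suc k)) (\<lambda>\<tau>. \<tau>))"
  proof (rule bij_betw_byWitness[where f' = "\<lambda>(\<tau>, v). (\<tau> - {v}, v)"])
    show "(\<lambda>(\<tau>, v). (\<tau> - {v}, v)) ` Sigma (?F (Suc k)) (\<lambda>\<tau>. \<tau>) \<subseteq> Sigma (?F k) ?ext"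
      using indep_subset by (auto simp: insert_absorb)
  qed (auto simp: insert_absorb)
  then have "card (Sigma (?F k) ?ext) = card (Sigma (?F (Suc k)) (\<lambda>\<tau>. \<tau>))"
    by (rule bij_betw_same_card)
  then have "(\<Sum>\<sigma>\<in>?F k. card (?ext \<sigma>)) = (\<Sum>\<tau>\<in>?F (Suc k). card \<tau>)"
    by simp
  moreover have "(\<Sum>\<sigma>\<in>?F k. card (?ext \<sigma>)) = (\<Sum>\<sigma>\<in>?F k. e k)"
    by (intro sum.cong) (auto simp: ext)
  moreover have "(\<Sum>\<tau>\<in>?F (Suc k). card \<tau>) = (\<Sum>\<tau>\<in>?F (Suc k). Suc k)"
    by (intro sum.cong) auto
  ultimately have "card (?F k) * e k = card (?F (Suc k)) * Suc k"
    by simp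
  then have "real (card (?F k)) * real (e k) = real (card (?F (Suc k))) * real (Suc k)"
    by (simp only: of_nat_mult[symmetric])
  then have "real (card (?F (Suc k))) = real (card (?F k)) * real (e k) / real (Suc k)"
    by (simp add: eq_divide_eq del: of_nat_Suc)
  then show ?case
    unfolding Suc.IH by (simp add: mult.commute del: of_nat_Suc)
qed

lemma card_critical_uniform:
  assumes ext: "\<And>\<sigma>. indep \<sigma> \<Longrightarrow> card {v. v \<notin> \<sigma> \<and> indep (insert v \<sigma>)} = e (card \<sigma>)"
  shows "real (card critical) = (-1) ^ r +
    (\<Sum>i = 0..r - 1. (-1) ^ (r - 1 - i) * ((\<Prod>j = 0..i. real (e j)) / fact (i + 1)))"
proof -
  let ?g = "\<lambda>k. (-1) ^ (r - k) * ((\<Prod>j<k. real (e j)) / fact k)"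
  \<comment> \<open>The summand of the empty set is split off; it is the leading sign.\<close>
  have r: "r = Suc (r - 1)" using rank_pos by simp
  have "real (card critical) = (\<Sum>k\<le>r. ?g k)"
    by (simp only: card_critical card_indep_of_card[OF ext])
  also have "\<dots> = ?g 0 + (\<Sum>i\<le>r - 1. ?g (Suc i))"
    by (subst r) (rule sum.atMost_Suc_shift)
  also have "(\<Sum>i\<le>r - 1. ?g (Suc i))
      = (\<Sum>i = 0..r - 1. (-1) ^ (r - 1 - i) * ((\<Prod>j = 0..i. real (e j)) / fact (i + 1)))"
    unfolding atLeast0AtMost lessThan_Suc_atMost by (intro sum.cong) auto
  finally show ?thesis by simp
qed

end

section \<open>Linear independence over finite fields\<close>

lemma card_subspace:
  fixes W :: "('f::{field,finite} ^ 'n) set"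
  assumes "vec.subspace W"
  shows "card W = CARD('f) ^ vec.dim W"
proof -
  obtain B where B: "B \<subseteq> W" "vec.independent B" "W \<subseteq> vec.span B" "card B = vec.dim W"
    using vec.basis_exists by blast
  have span: "vec.span B = W" using B assms by (meson vec.span_minimal subset_antisym)
  let ?comb = "\<lambda>u :: _ \<Rightarrow> 'f. \<Sum>v\<in>B. u v *s v"
  have "bij_betw ?comb (B \<rightarrow>\<^sub>E UNIV) W"
  proof (rule bij_betwI')
    fix u u' :: "'f ^ 'n \<Rightarrow> 'f" assume u: "u \<in> B \<rightarrow>\<^sub>E UNIV" "u' \<in> B \<rightarrow>\<^sub>E UNIV"
    show "?comb u = ?comb u' \<longleftrightarrow> u = u'"
    proof
      assume "?comb u = ?comb u'"
      then have "(\<Sum>v\<in>B. (u v - u' v) *s v) = 0"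
        by (simp add: vector_sub_rdistrib sum_subtractf)
      then have "u v - u' v = 0" if "v \<in> B" for v
        using vec.independentD[OF B(2), of B "\<lambda>v. u v - u' v" v] that by simp
      then show "u = u'" using u by (intro PiE_ext[OF u]) simp
    qed simp
  next
    fix u :: "'f ^ 'n \<Rightarrow> 'f" show "?comb u \<in> W"
      unfolding span[symmetric] by (intro vec.span_sum vec.span_scale vec.span_base)
  next
    fix w assume "w \<in> W"
    then obtain u where u: "w = ?comb u" using vec.span_finite[of B] span by auto
    then show "\<exists>u\<in>B \<rightarrow>\<^sub>E UNIV. w = ?comb u"
      by (intro bexI[of _ "restrict u B"]) auto
  qed
  then have "card W = card (B \<rightarrow>\<^sub>E (UNIV :: 'f set))"
    by (simp add: bij_betw_same_card)
  then show ?thesis by (simp add: card_PiE B(4))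
qed

lemma matroid_X:
  "matroid_of_rank (\<lambda>\<sigma>. vec.independent (\<sigma> :: ('f::{field,finite} ^ 'n) set)) CARD('n)"
proof
  fix \<sigma> \<tau> :: "('f ^ 'n) set"
  show "vec.independent \<sigma> \<Longrightarrow> \<tau> \<subseteq> \<sigma> \<Longrightarrow> vec.independent \<tau>"
    by (rule vec.independent_mono)
  show "\<exists>v\<in>\<tau> - \<sigma>. vec.independent (insert v \<sigma>)"
    if "vec.independent \<sigma>" "vec.independent \<tau>" "card \<sigma> < card \<tau>"
  proof -
    have "\<not> \<tau> \<subseteq> vec.span \<sigma>"
      using vec.independent_span_bound[of \<sigma> \<tau>] that by auto
    then obtain v where "v \<in> \<tau>" "v \<notin> vec.span \<sigma>" by blast
    then show ?thesis using that(1) vec.span_base vec.independent_insertI by blast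
  qed
  show "vec.independent \<sigma> \<Longrightarrow> card \<sigma> \<le> CARD('n)"
    using vec.independent_card_le_dim[of \<sigma> UNIV] by (simp only: vec_dim_card) simp
  show "\<exists>\<sigma> :: ('f ^ 'n) set. vec.independent \<sigma> \<and> card \<sigma> = CARD('n)"
    using vec.basis_exists[of UNIV] by (metis vec_dim_card)
qed simp

lemma X_extensions:
  fixes \<sigma> :: "('f::{field,finite} ^ 'n) set"
  assumes "vec.independent \<sigma>"
  shows "card {v. v \<notin> \<sigma> \<and> vec.independent (insert v \<sigma>)} = CARD('f) ^ CARD('n) - CARD('f) ^ card \<sigma>"
proof -
  have "{v. v \<notin> \<sigma> \<and> vec.independent (insert v \<sigma>)} = UNIV - vec.span \<sigma>"
    using assms by (auto simp: vec.independent_insert vec.span_base split: if_splits)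
  moreover have "card (vec.span \<sigma>) = CARD('f) ^ card \<sigma>"
    using card_subspace[OF vec.subspace_span, of \<sigma>] vec.dim_span_eq_card_independent[OF assms] by simp
  ultimately show ?thesis by (simp add: card_Diff_subset)
qed

lemma line_eq_span:
  assumes "L \<in> lines" "x \<in> L" "x \<noteq> 0"
  shows "L = vec.span {x}"
proof -
  have "vec.dim {x} = 1" using assms(3) by (simp add: vec.dim_insert)
  then show ?thesis
    using assms vec.subspace_dim_equal[of "vec.span {x}" L]
    by (simp add: lines_def vec.span_minimal)
qed

lemma line_generator:
  assumes "L \<in> lines"
  obtains x where "x \<in> L" "x \<noteq> 0"
proof -
  have "\<not> L \<subseteq> {0}"
    using assms vec.dim_eq_0[of L] by (auto simp: lines_def)
  then show thesis using that by blast
qed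

lemma span_singleton_line: "x \<noteq> 0 \<Longrightarrow> vec.span {x} \<in> lines"
  by (simp add: lines_def vec.dim_insert)

text \<open>
  Membership in \<open>K_complex\<close>, extended to the empty set of lines.
\<close>

definition independent_lines :: "('f::field ^ 'n) set set \<Rightarrow> bool" where
  "independent_lines \<sigma> \<longleftrightarrow> \<sigma> \<subseteq> lines \<and> vec.dim (\<Union>\<sigma>) = card \<sigma>"

text \<open>
  A line has the same span as any of its nonzero vectors, so it raises the dimension by one if it is
  not contained in the span, and not at all otherwise.
\<close>

lemma independent_lines_insert:
  fixes \<sigma> :: "('f::{field,finite} ^ 'n) set set"
  assumes "independent_lines \<sigma>" and L: "L \<in> lines"
  shows "L \<notin> \<sigma> \<and> independent_lines (insert L \<sigma>) \<longleftrightarrow> \<not> L \<subseteq> vec.span (\<Union>\<sigma>)"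
proof -
  obtain x where x: "x \<in> L" "x \<noteq> 0" using line_generator[OF L] by blast
  have Lx: "L = vec.span {x}" using line_eq_span[OF L x] .
  have "vec.span (\<Union>(insert L \<sigma>)) = vec.span (insert x (\<Union>\<sigma>))"
  proof (rule subset_antisym; rule vec.span_minimal[OF _ vec.subspace_span])
    have "L \<subseteq> vec.span (insert x (\<Union>\<sigma>))"
      unfolding Lx by (rule vec.span_mono) simp
    moreover have "\<Union>\<sigma> \<subseteq> vec.span (insert x (\<Union>\<sigma>))"
      using vec.span_superset[of "insert x (\<Union>\<sigma>)"] by simp
    ultimately show "\<Union>(insert L \<sigma>) \<subseteq> vec.span (insert x (\<Union>\<sigma>))" by simp
    show "insert x (\<Union>\<sigma>) \<subseteq> vec.span (\<Union>(insert L \<sigma>))"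
      using x(1) vec.span_superset[of "\<Union>(insert L \<sigma>)"] by blast
  qed
  then have "vec.dim (\<Union>(insert L \<sigma>)) = vec.dim (insert x (\<Union>\<sigma>))"
    by (metis vec.dim_span)
  also have "\<dots> = (if x \<in> vec.span (\<Union>\<sigma>) then vec.dim (\<Union>\<sigma>) else vec.dim (\<Union>\<sigma>) + 1)"
    by (rule vec.dim_insert)
  finally have dim: "vec.dim (\<Union>(insert L \<sigma>))
      = (if x \<in> vec.span (\<Union>\<sigma>) then card \<sigma> else card \<sigma> + 1)"
    using assms(1) by (simp add: independent_lines_def)
  have xL: "x \<in> vec.span (\<Union>\<sigma>) \<longleftrightarrow> L \<subseteq> vec.span (\<Union>\<sigma>)"
    using x(1) vec.span_minimal[OF _ vec.subspace_span, of "{x}"] unfolding Lx by blast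
  have L\<sigma>: "L \<subseteq> vec.span (\<Union>\<sigma>)" if "L \<in> \<sigma>"
    using that vec.span_superset[of "\<Union>\<sigma>"] by blast
  show ?thesis
    using assms dim L\<sigma> unfolding independent_lines_def xL
    by (cases "L \<in> \<sigma>") (auto split: if_splits)
qed

lemma K_complex_eq:
  "K_complex = {\<sigma>. independent_lines (\<sigma> :: ('f::{field,finite} ^ 'n) set set) \<and> \<sigma> \<noteq> {}}"
  by (auto simp: K_complex_def independent_lines_def vec.dim_span)

lemma matroid_K: "matroid_of_rank (independent_lines :: ('f::{field,finite} ^ 'n) set set \<Rightarrow> bool) CARD('n)"
proof
  fix \<sigma> \<tau> :: "('f ^ 'n) set set"
  show "independent_lines \<tau>" if "independent_lines \<sigma>" "\<tau> \<subseteq> \<sigma>"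
  proof (cases "\<tau> = {}")
    case True
    then show ?thesis by (simp add: independent_lines_def)
  next
    case False
    then have "\<sigma> \<in> K_complex" using that by (auto simp: K_complex_eq)
    then have "\<tau> \<in> K_complex"
      using simplicial_complex_face[OF abstract_simplicial_complex_K] that(2) False by blast
    then show ?thesis by (simp add: K_complex_eq)
  qed
  show "\<exists>L\<in>\<tau> - \<sigma>. independent_lines (insert L \<sigma>)"
    if \<sigma>: "independent_lines \<sigma>" and \<tau>: "independent_lines \<tau>" and less: "card \<sigma> < card \<tau>"
  proof -
    have "\<not> \<Union>\<tau> \<subseteq> vec.span (\<Union>\<sigma>)"
    proof
      assume "\<Union>\<tau> \<subseteq> vec.span (\<Union>\<sigma>)"
      then have "vec.dim (\<Union>\<tau>) \<le> vec.dim (vec.span (\<Union>\<sigma>))" by (rule vec.dim_subset)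
      then show False using \<sigma> \<tau> less by (simp add: independent_lines_def vec.dim_span)
    qed
    then obtain L where "L \<in> \<tau>" "\<not> L \<subseteq> vec.span (\<Union>\<sigma>)" by blast
    moreover from this have "L \<in> lines" using \<tau> by (auto simp: independent_lines_def)
    ultimately show ?thesis
      using independent_lines_insert[OF \<sigma>, of L] by blast
  qed
  show "card \<sigma> \<le> CARD('n)" if "independent_lines \<sigma>"
    using that dim_subset_UNIV_cart_gen[of "\<Union>\<sigma>"] by (simp add: independent_lines_def)
  have "\<exists>\<sigma> :: ('f ^ 'n) set set. independent_lines \<sigma> \<and> card \<sigma> = k" if "k \<le> CARD('n)" for k
    using that
  proof (induction k)
    case 0
    show ?case by (intro exI[of _ "{}"]) (simp add: independent_lines_def)
  next
    case (Suc k)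
    then obtain \<sigma> :: "('f ^ 'n) set set" where \<sigma>: "independent_lines \<sigma>" "card \<sigma> = k" by auto
    have "vec.span (\<Union>\<sigma>) \<noteq> UNIV"
    proof
      assume "vec.span (\<Union>\<sigma>) = UNIV"
      then have "vec.dim (\<Union>\<sigma>) = CARD('n)" by (metis vec.dim_span vec_dim_card)
      then show False using \<sigma> Suc.prems by (simp add: independent_lines_def)
    qed
    then obtain x where x: "x \<notin> vec.span (\<Union>\<sigma>)" by blast
    then have "x \<noteq> 0" using vec.span_zero by metis
    then have L: "vec.span {x} \<in> lines" by (rule span_singleton_line)
    have "\<not> vec.span {x} \<subseteq> vec.span (\<Union>\<sigma>)" using x vec.span_base[of x "{x}"] by blast
    then have "vec.span {x} \<notin> \<sigma>" "independent_lines (insert (vec.span {x}) \<sigma>)"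
      using independent_lines_insert[OF \<sigma>(1) L] by blast+
    then show ?case using \<sigma>(2) by (intro exI[of _ "insert (vec.span {x}) \<sigma>"]) simp
  qed
  then show "\<exists>\<sigma> :: ('f ^ 'n) set set. independent_lines \<sigma> \<and> card \<sigma> = CARD('n)" by blast
qed simp

text \<open>
  The nonzero vectors of the lines not contained in \<open>W\<close> partition the complement of \<open>W\<close>.
\<close>

lemma card_lines_outside:
  fixes W :: "('f::{field,finite} ^ 'n) set"
  assumes W: "vec.subspace W"
  shows "card {L \<in> lines. \<not> L \<subseteq> W} * (CARD('f) - 1) = CARD('f) ^ CARD('n) - CARD('f) ^ vec.dim W"
proof -
  let ?N = "{L \<in> lines. \<not> L \<subseteq> W}"
  have mem: "x \<notin> W" if "L \<in> ?N" "x \<in> L" "x \<noteq> 0" for L x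
  proof
    assume "x \<in> W"
    then have "vec.span {x} \<subseteq> W" using W by (intro vec.span_minimal) auto
    then show False using line_eq_span[of L x] that by auto
  qed
  have zero: "0 \<in> W" using W by (rule vec.subspace_0)
  have "UNIV - W = (\<Union>L\<in>?N. L - {0})"
  proof (intro subset_antisym subsetI)
    fix x assume "x \<in> UNIV - W"
    then have x: "x \<notin> W" "x \<noteq> 0" using zero by auto
    then have "vec.span {x} \<in> ?N" "x \<in> vec.span {x} - {0}"
      using span_singleton_line[of x] vec.span_base[of x "{x}"] by auto
    then show "x \<in> (\<Union>L\<in>?N. L - {0})" by blast
  next
    fix x assume "x \<in> (\<Union>L\<in>?N. L - {0})"
    then show "x \<in> UNIV - W" using mem by blast
  qed
  moreover have "card (\<Union>L\<in>?N. L - {0}) = (\<Sum>L\<in>?N. card (L - {0}))"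
  proof (rule card_UN_disjoint)
    show "\<forall>L\<in>?N. \<forall>L'\<in>?N. L \<noteq> L' \<longrightarrow> (L - {0}) \<inter> (L' - {0}) = {}"
      using line_eq_span by blast
  qed auto
  moreover have "(\<Sum>L\<in>?N. card (L - {0})) = (\<Sum>L\<in>?N. CARD('f) - 1)"
  proof (rule sum.cong)
    fix L assume "L \<in> ?N"
    then have "vec.subspace L" "vec.dim L = 1" by (auto simp: lines_def)
    then show "card (L - {0}) = CARD('f) - 1"
      using card_subspace[of L] vec.subspace_0[of L] by (simp add: card_Diff_singleton)
  qed simp
  ultimately have "card ?N * (CARD('f) - 1) = card (UNIV - W)" by simp
  also have "\<dots> = CARD('f) ^ CARD('n) - CARD('f) ^ vec.dim W"
    using card_subspace[OF W] by (simp add: card_Diff_subset)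
  finally show ?thesis .
qed

lemma K_extensions:
  fixes \<sigma> :: "('f::{field,finite} ^ 'n) set set"
  assumes "independent_lines \<sigma>" and "CARD('f) > 1"
  shows "card {L. L \<notin> \<sigma> \<and> independent_lines (insert L \<sigma>)}
    = (CARD('f) ^ CARD('n) - CARD('f) ^ card \<sigma>) div (CARD('f) - 1)"
proof -
  have "{L. L \<notin> \<sigma> \<and> independent_lines (insert L \<sigma>)} = {L \<in> lines. \<not> L \<subseteq> vec.span (\<Union>\<sigma>)}"
    using independent_lines_insert[OF assms(1)] by (auto simp: independent_lines_def)
  moreover have "vec.dim (vec.span (\<Union>\<sigma>)) = card \<sigma>"
    using assms(1) by (simp add: independent_lines_def vec.dim_span)
  ultimately have "card {L. L \<notin> \<sigma> \<and> independent_lines (insert L \<sigma>)} * (CARD('f) - 1)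
      = CARD('f) ^ CARD('n) - CARD('f) ^ card \<sigma>"
    using card_lines_outside[OF vec.subspace_span, of "\<Union>\<sigma>"] by simp
  from this[symmetric] show ?thesis
    using assms(2) by simp
qed

theorem theorem3p3:
  fixes p n :: nat
  assumes "p = CARD('p::prime_card)" and "n = CARD('n::finite)"
  shows "(n \<ge> 1 \<longrightarrow>
           (\<exists>m::nat. real m = A_number n p \<and>
              top_of_set (geometric_realisation (X_complex :: ('p mod_ring ^ 'n) set set))
                homotopy_equivalent_space wedge_of_spheres m (n - 1))) \<and>
         (n > 1 \<longrightarrow>
           (\<exists>m::nat. real m = B_number n p \<and>
              top_of_set (geometric_realisation (K_complex :: ('p mod_ring ^ 'n) set set set))
                homotopy_equivalent_space wedge_of_spheres m (n - 1)))"
proof -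
  have q: "CARD('p mod_ring) = p" using assms by simp
  have p1: "p > 1" using assms prime_card[where 'a = 'p] prime_gt_1_nat by blast
  have mono: "p ^ j \<le> p ^ n" if "j \<le> n" for j
    using p1 that by (intro power_increasing) auto
  interpret X: matroid_of_rank "\<lambda>\<sigma> :: ('p mod_ring ^ 'n) set. vec.independent \<sigma>" n
    unfolding assms(2) by (rule matroid_X)
  interpret K: matroid_of_rank "independent_lines :: ('p mod_ring ^ 'n) set set \<Rightarrow> bool" n
    unfolding assms(2) by (rule matroid_K)
  have X_eq: "X_complex = {\<sigma> :: ('p mod_ring ^ 'n) set. vec.independent \<sigma> \<and> \<sigma> \<noteq> {}}"
    by (auto simp: X_complex_def)
  have "real (card X.critical) = A_number n p"
  proof -
    have "real (card X.critical) = (-1) ^ n + (\<Sum>i = 0..n - 1. (-1) ^ (n - 1 - i) *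
        ((\<Prod>j = 0..i. real (p ^ n - p ^ j)) / fact (i + 1)))"
      by (rule X.card_critical_uniform) (simp add: X_extensions assms[symmetric])
    also have "\<dots> = A_number n p"
      unfolding A_number_def using X.rank_pos
      by (intro arg_cong2[where f = "(+)"] arg_cong2[where f = "(*)"] arg_cong2[where f = "(/)"]
          sum.cong prod.cong refl) (auto simp: of_nat_diff mono)
    finally show ?thesis .
  qed
  moreover have "real (card K.critical) = B_number n p"
  proof -
    have quotient: "real ((p ^ n - p ^ j) div (p - 1)) = (real p ^ n - real p ^ j) / (real p - 1)"
      if j: "j < n" for j
    proof -
      obtain W :: "('p mod_ring ^ 'n) set" where W: "vec.subspace W" "vec.dim W = j"
        using vec.choose_subspace_of_subspace[of j UNIV] j assms(2) by (metis vec_dim_card less_imp_le)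
      have eq: "p ^ n - p ^ j = card {L \<in> lines. \<not> L \<subseteq> W} * (p - 1)"
        using card_lines_outside[OF W(1), symmetric] unfolding W(2) q assms(2)[symmetric] .
      have "(p - 1) dvd (p ^ n - p ^ j)"
        unfolding eq by (rule dvd_triv_right)
      then show ?thesis
        using p1 mono[of j] j by (simp add: real_of_nat_div of_nat_diff)
    qed
    have "real (card K.critical) = (-1) ^ n + (\<Sum>i = 0..n - 1. (-1) ^ (n - 1 - i) *
        ((\<Prod>j = 0..i. real ((p ^ n - p ^ j) div (p - 1))) / fact (i + 1)))"
      by (rule K.card_critical_uniform) (use p1 in \<open>simp add: K_extensions assms[symmetric]\<close>)
    also have "\<dots> = B_number n p"
      unfolding B_number_def
    proof (intro arg_cong2[where f = "(+)"] arg_cong2[where f = "(*)"] sum.cong refl)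
      fix i assume "i \<in> {0..n - 1}"
      then have "(\<Prod>j = 0..i. real ((p ^ n - p ^ j) div (p - 1)))
          = (\<Prod>j = 0..i. (real p ^ n - real p ^ j) / (real p - 1))"
        using K.rank_pos by (intro prod.cong refl quotient) auto
      also have "\<dots> = (\<Prod>j = 0..i. real p ^ n - real p ^ j) / (real p - 1) ^ (i + 1)"
        by (simp add: prod_dividef)
      finally show "(\<Prod>j = 0..i. real ((p ^ n - p ^ j) div (p - 1))) / fact (i + 1)
          = (\<Prod>j = 0..i. real p ^ n - real p ^ j) / ((real p - 1) ^ (i + 1) * fact (i + 1))"
        by simp
    qed
    finally show ?thesis .
  qed
  ultimately show ?thesis
    using X.independence_complex_wedge_of_spheres K.independence_complex_wedge_of_spheres
    unfolding X_eq K_complex_eq by blast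
qed

end
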